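(* Let $\bar{x}\in\mathcal{F}$ be a locally optimal solution of (MPSC). Assume that the MPSC piecewise weak constant rank condition (MPSC-PWCR) and the MPSC piecewise second-order quasi-normality (MPSC-PSOQN) both hold at $\bar{x}$. Then the penalty problem admits a local exact penalization at $\bar{x}$: there exists $\bar\kappa>0$ such that $\bar{x}$ is a locally optimal solution of the penalty problem with parameter $\kappa$ for all $\kappa>\bar\kappa$.
   Context: (MPSC) is the problem: minimize $f(x)$ over $x\in\mathbb{R}^n$ subject to $g_i(x)\le 0$ ($i=1,\dots,m$), $h_j(x)=0$ ($j=1,\dots,p$), $G_k(x)H_k(x)=0$ ($k=1,\dots,l$), where $f,g_i,h_j,G_k,H_k:\mathbb{R}^n\to\mathbb{R}$ are twice continuously differentiable. $\mathcal{F}$ denotes its feasible set. For a feasible point $\bar{x}$: $\mathcal{I}_h=\{1,\dots,p\}$, $\mathcal{I}_g=\{i: g_i(\bar{x})=0\}$, $\mathcal{I}_G=\{k: G_k(\bar{x})=0,\,H_k(\bar{x})\neq0\}$, $\mathcal{I}_H=\{k: G_k(\bar{x})\ne0,\,H_k(\bar{x})=0\}$, $\mathcal{I}_{GH}=\{k: G_k(\bar{x})=H_k(\bar{x})=0\}$. $\mathcal{P}(\mathcal{I}_{GH})$ is the set of all pairs $(\beta_1,\beta_2)$ of disjoint (possibly empty) sets with $\beta_1\cup\beta_2=\mathcal{I}_{GH}$. MPSC-PWCR holds at $\bar{x}$ if for each $(\beta_1,\beta_2)\in\mathcal{P}(\mathcal{I}_{GH})$ there is $\varepsilon>0$ such that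 the rank of the family $\{\nabla g_i(x)\}_{i\in\mathcal{I}_g}\cup\{\nabla h_j(x)\}_{j\in\mathcal{I}_h}\cup\{\nabla G_k(x)\}_{k\in\mathcal{I}_G\cup\beta_1}\cup\{\nabla H_k(x)\}_{k\in\mathcal{I}_H\cup\beta_2}$ is constant for all $x$ with $\|x-\bar{x}\|<\varepsilon$. MPSC-PSOQN holds at $\bar{x}$ if for each $(\beta_1,\beta_2)\in\mathcal{P}(\mathcal{I}_{GH})$ there is no nonzero vector $(\lambda,\rho,\mu,\nu)$ (with $\lambda\in\mathbb{R}^m$, $\rho\in\mathbb{R}^p$, $\mu$ indexed by $\mathcal{I}_G\cup\beta_1$, $\nu$ indexed by $\mathcal{I}_H\cup\beta_2$) with $\lambda\ge0$ satisfying all of: (1) $\sum_{i=1}^m\lambda_i\nabla g_i(\bar{x})+\sum_{j=1}^p\rho_j\nabla h_j(\bar{x})+\sum_{k\in\mathcal{I}_G\cup\beta_1}\mu_k\nabla G_k(\bar{x})+\sum_{k\in\mathcal{I}_H\cup\beta_2}\nu_k\nabla H_k(\bar{x})=0$; (2) $\tilde d^\top\big(\sum_{i=1}^m\lambda_i\nabla^2 g_i(\bar{x})+\sum_{j=1}^p\rho_j\nabla^2 h_j(\bar{x})+\sum_{k\in\mathcal{I}_G\cup\beta_1}\mu_k\nabla^2 G_k(\bar{x})+\sum_{k\in\mathcal{I}_H\cup\beta_2}\nu_k\nabla^2 H_k(\bar{x})\big)\tilde d\ge0$ for all $\tilde d$ in the critical subspace $\{d\in\mathbb{R}^n:\nabla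 g_i(\bar{x})^\top d=0\ (i\in\mathcal{I}_g),\ \nabla h_j(\bar{x})^\top d=0\ (j\in\mathcal{I}_h),\ \nabla G_k(\bar{x})^\top d=0\ (k\in\mathcal{I}_G\cup\beta_1),\ \nabla H_k(\bar{x})^\top d=0\ (k\in\mathcal{I}_H\cup\beta_2)\}$; (3) there is a sequence $x^s\to\bar{x}$ such that for each $s$: $\lambda_i>0\Rightarrow\lambda_ig_i(x^s)>0$; $\rho_j\ne0\Rightarrow\rho_jh_j(x^s)>0$; $\mu_k\neq0\Rightarrow\mu_kG_k(x^s)>0$; $\nu_k\ne0\Rightarrow\nu_kH_k(x^s)>0$. The penalty problem with parameter $\kappa>0$ is: minimize over $x\in\mathbb{R}^n$ the function $$f(x)+\kappa\Big(\sum_{i=1}^m[g_i^+(x)]^2+\sum_{j=1}^p[h_j(x)]^2+\sum_{k=1}^l\min\{[G_k(x)]^2,[H_k(x)]^2\}\Big)^{1/2},\qquad g_i^+(x)=\max\{g_i(x),0\}.$$ *)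

theory Defs
  imports "HOL-Analysis.Analysis"
begin

definition grad :: "(real^'n \<Rightarrow> real) \<Rightarrow> real^'n \<Rightarrow> real^'n" where
  "grad f x = (THE D. GDERIV f x :> D)"

lemma GDERIV_grad:
  fixes f :: "real^'n \<Rightarrow> real"
  assumes "f differentiable (at x)"
  shows "GDERIV f x :> grad f x"
proof -
  obtain f' where f': "(f has_derivative f') (at x)"
    using assms by (auto simp: differentiable_def)
  let ?D = "\<Sum>b\<in>Basis. f' b *\<^sub>R b"
  have lin: "linear f'"
    using f' by (rule has_derivative_linear)
  have "f' h = h \<bullet> ?D" for h
  proof -
    have "f' h = f' (\<Sum>b\<in>Basis. (h \<bullet> b) *\<^sub>R b)"
      by (simp add: euclidean_representation)
    also have "\<dots> = (\<Sum>b\<in>Basis. (h \<bullet> b) * f' b)"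
      by (simp add: linear_sum[OF lin] linear_cmul[OF lin])
    also have "\<dots> = h \<bullet> ?D"
      by (simp add: inner_sum_right mult.commute)
    finally show ?thesis .
  qed
  then have "f' = (\<lambda>h. h \<bullet> ?D)" by blast
  with f' have D: "GDERIV f x :> ?D"
    by (simp add: gderiv_def)
  have "E = ?D" if "GDERIV f x :> E" for E
  proof -
    have "(\<lambda>h. h \<bullet> E) = (\<lambda>h. h \<bullet> ?D)"
      using that D unfolding gderiv_def by (rule has_derivative_unique)
    then have "h \<bullet> E = h \<bullet> ?D" for h by meson
    then show ?thesis using vector_eq_ldot by blast
  qed
  with D show ?thesis
    unfolding grad_def by (rule theI)
qed

definition hessian :: "(real^'n \<Rightarrow> real) \<Rightarrow> real^'n \<Rightarrow> real^'n^'n" where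
  "hessian f x = jacobian (grad f) (at x)"

definition twice_cont_diff :: "(real^'n \<Rightarrow> real) \<Rightarrow> bool" where
  "twice_cont_diff f \<longleftrightarrow>
     (\<forall>x. f differentiable (at x)) \<and> (\<forall>x. grad f differentiable (at x)) \<and>
     continuous_on UNIV (hessian f)"

definition locally_optimal :: "('a::metric_space \<Rightarrow> real) \<Rightarrow> 'a set \<Rightarrow> 'a \<Rightarrow> bool" where
  "locally_optimal \<phi> S xbar \<longleftrightarrow>
     xbar \<in> S \<and> (\<exists>\<epsilon>>0. \<forall>x\<in>S \<inter> ball xbar \<epsilon>. \<phi> xbar \<le> \<phi> x)"

text \<open>Constraint functions are meaningful only at the indices \<open>1, \<dots>, n_ineq\<close> (resp. \<open>n_eq\<close>,
  \<open>n_sw\<close>); the values at other indices are never used. Each number may be zero.\<close>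

record ('n::finite) mpsc =
  obj :: "real^'n \<Rightarrow> real"
  n_ineq :: nat
  n_eq :: nat
  n_sw :: nat
  g_fun :: "nat \<Rightarrow> real^'n \<Rightarrow> real"
  h_fun :: "nat \<Rightarrow> real^'n \<Rightarrow> real"
  G_fun :: "nat \<Rightarrow> real^'n \<Rightarrow> real"
  H_fun :: "nat \<Rightarrow> real^'n \<Rightarrow> real"

definition mpsc_smooth :: "'n::finite mpsc \<Rightarrow> bool" where
  "mpsc_smooth P \<longleftrightarrow>
     twice_cont_diff (obj P) \<and>
     (\<forall>i\<in>{1..n_ineq P}. twice_cont_diff (g_fun P i)) \<and>
     (\<forall>j\<in>{1..n_eq P}. twice_cont_diff (h_fun P j)) \<and>
     (\<forall>k\<in>{1..n_sw P}. twice_cont_diff (G_fun P k) \<and> twice_cont_diff (H_fun P k))"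

definition feasible :: "'n::finite mpsc \<Rightarrow> (real^'n) set" where
  "feasible P = {x. (\<forall>i\<in>{1..n_ineq P}. g_fun P i x \<le> 0) \<and>
                    (\<forall>j\<in>{1..n_eq P}. h_fun P j x = 0) \<and>
                    (\<forall>k\<in>{1..n_sw P}. G_fun P k x * H_fun P k x = 0)}"

definition I_h :: "'n::finite mpsc \<Rightarrow> nat set" where
  "I_h P = {1..n_eq P}"

definition I_g :: "'n::finite mpsc \<Rightarrow> real^'n \<Rightarrow> nat set" where
  "I_g P xbar = {i\<in>{1..n_ineq P}. g_fun P i xbar = 0}"

definition I_G :: "'n::finite mpsc \<Rightarrow> real^'n \<Rightarrow> nat set" where
  "I_G P xbar = {k\<in>{1..n_sw P}. G_fun P k xbar = 0 \<and> H_fun P k xbar \<noteq> 0}"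

definition I_H :: "'n::finite mpsc \<Rightarrow> real^'n \<Rightarrow> nat set" where
  "I_H P xbar = {k\<in>{1..n_sw P}. G_fun P k xbar \<noteq> 0 \<and> H_fun P k xbar = 0}"

definition I_GH :: "'n::finite mpsc \<Rightarrow> real^'n \<Rightarrow> nat set" where
  "I_GH P xbar = {k\<in>{1..n_sw P}. G_fun P k xbar = 0 \<and> H_fun P k xbar = 0}"

definition bipartitions :: "nat set \<Rightarrow> (nat set \<times> nat set) set" where
  "bipartitions I = {(\<beta>1, \<beta>2). \<beta>1 \<inter> \<beta>2 = {} \<and> \<beta>1 \<union> \<beta>2 = I}"

text \<open>The gradients are evaluated at \<open>x\<close>, while the index sets are those of \<open>xbar\<close>. The rank of
  a family of vectors is the dimension of the span of its members.\<close>

definition gradient_family ::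
  "'n::finite mpsc \<Rightarrow> real^'n \<Rightarrow> nat set \<Rightarrow> nat set \<Rightarrow> real^'n \<Rightarrow> (real^'n) set" where
  "gradient_family P xbar \<beta>1 \<beta>2 x =
     (\<lambda>i. grad (g_fun P i) x) ` I_g P xbar \<union>
     (\<lambda>j. grad (h_fun P j) x) ` I_h P \<union>
     (\<lambda>k. grad (G_fun P k) x) ` (I_G P xbar \<union> \<beta>1) \<union>
     (\<lambda>k. grad (H_fun P k) x) ` (I_H P xbar \<union> \<beta>2)"

definition MPSC_PWCR :: "'n::finite mpsc \<Rightarrow> real^'n \<Rightarrow> bool" where
  "MPSC_PWCR P xbar \<longleftrightarrow>
     (\<forall>(\<beta>1, \<beta>2)\<in>bipartitions (I_GH P xbar).
        \<exists>\<epsilon>>0. (\<lambda>x. dim (gradient_family P xbar \<beta>1 \<beta>2 x)) constant_on ball xbar \<epsilon>)"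

definition critical_subspace ::
  "'n::finite mpsc \<Rightarrow> real^'n \<Rightarrow> nat set \<Rightarrow> nat set \<Rightarrow> (real^'n) set" where
  "critical_subspace P xbar \<beta>1 \<beta>2 =
     {d. (\<forall>i\<in>I_g P xbar. grad (g_fun P i) xbar \<bullet> d = 0) \<and>
         (\<forall>j\<in>I_h P. grad (h_fun P j) xbar \<bullet> d = 0) \<and>
         (\<forall>k\<in>I_G P xbar \<union> \<beta>1. grad (G_fun P k) xbar \<bullet> d = 0) \<and>
         (\<forall>k\<in>I_H P xbar \<union> \<beta>2. grad (H_fun P k) xbar \<bullet> d = 0)}"

text \<open>The multipliers \<open>\<lambda>, \<rho>, \<mu>, \<nu>\<close> are functions on all of \<open>nat\<close> of which only the values on the
  index sets \<open>{1..n_ineq P}\<close>, \<open>{1..n_eq P}\<close>, \<open>I_G P xbar \<union> \<beta>1\<close> and \<open>I_H P xbar \<union> \<beta>2\<close> matter.\<close>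

definition nonzero_multiplier ::
  "'n::finite mpsc \<Rightarrow> real^'n \<Rightarrow> nat set \<Rightarrow> nat set \<Rightarrow>
   (nat \<Rightarrow> real) \<Rightarrow> (nat \<Rightarrow> real) \<Rightarrow> (nat \<Rightarrow> real) \<Rightarrow> (nat \<Rightarrow> real) \<Rightarrow> bool" where
  "nonzero_multiplier P xbar \<beta>1 \<beta>2 lam \<rho> \<mu> \<nu> \<longleftrightarrow>
     (\<exists>i\<in>{1..n_ineq P}. lam i \<noteq> 0) \<or> (\<exists>j\<in>{1..n_eq P}. \<rho> j \<noteq> 0) \<or>
     (\<exists>k\<in>I_G P xbar \<union> \<beta>1. \<mu> k \<noteq> 0) \<or> (\<exists>k\<in>I_H P xbar \<union> \<beta>2. \<nu> k \<noteq> 0)"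

definition stationary_multiplier ::
  "'n::finite mpsc \<Rightarrow> real^'n \<Rightarrow> nat set \<Rightarrow> nat set \<Rightarrow>
   (nat \<Rightarrow> real) \<Rightarrow> (nat \<Rightarrow> real) \<Rightarrow> (nat \<Rightarrow> real) \<Rightarrow> (nat \<Rightarrow> real) \<Rightarrow> bool" where
  "stationary_multiplier P xbar \<beta>1 \<beta>2 lam \<rho> \<mu> \<nu> \<longleftrightarrow>
     (\<Sum>i\<in>{1..n_ineq P}. lam i *\<^sub>R grad (g_fun P i) xbar) +
     (\<Sum>j\<in>{1..n_eq P}. \<rho> j *\<^sub>R grad (h_fun P j) xbar) +
     (\<Sum>k\<in>I_G P xbar \<union> \<beta>1. \<mu> k *\<^sub>R grad (G_fun P k) xbar) +
     (\<Sum>k\<in>I_H P xbar \<union> \<beta>2. \<nu> k *\<^sub>R grad (H_fun P k) xbar) = 0"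

definition multiplier_hessian ::
  "'n::finite mpsc \<Rightarrow> real^'n \<Rightarrow> nat set \<Rightarrow> nat set \<Rightarrow>
   (nat \<Rightarrow> real) \<Rightarrow> (nat \<Rightarrow> real) \<Rightarrow> (nat \<Rightarrow> real) \<Rightarrow> (nat \<Rightarrow> real) \<Rightarrow> real^'n^'n" where
  "multiplier_hessian P xbar \<beta>1 \<beta>2 lam \<rho> \<mu> \<nu> =
     (\<Sum>i\<in>{1..n_ineq P}. lam i *\<^sub>R hessian (g_fun P i) xbar) +
     (\<Sum>j\<in>{1..n_eq P}. \<rho> j *\<^sub>R hessian (h_fun P j) xbar) +
     (\<Sum>k\<in>I_G P xbar \<union> \<beta>1. \<mu> k *\<^sub>R hessian (G_fun P k) xbar) +
     (\<Sum>k\<in>I_H P xbar \<union> \<beta>2. \<nu> k *\<^sub>R hessian (H_fun P k) xbar)"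

definition quasi_normality_sequence ::
  "'n::finite mpsc \<Rightarrow> real^'n \<Rightarrow> nat set \<Rightarrow> nat set \<Rightarrow>
   (nat \<Rightarrow> real) \<Rightarrow> (nat \<Rightarrow> real) \<Rightarrow> (nat \<Rightarrow> real) \<Rightarrow> (nat \<Rightarrow> real) \<Rightarrow> (nat \<Rightarrow> real^'n) \<Rightarrow> bool" where
  "quasi_normality_sequence P xbar \<beta>1 \<beta>2 lam \<rho> \<mu> \<nu> xs \<longleftrightarrow>
     xs \<longlonglongrightarrow> xbar \<and>
     (\<forall>s. (\<forall>i\<in>{1..n_ineq P}. lam i > 0 \<longrightarrow> lam i * g_fun P i (xs s) > 0) \<and>
          (\<forall>j\<in>{1..n_eq P}. \<rho> j \<noteq> 0 \<longrightarrow> \<rho> j * h_fun P j (xs s) > 0) \<and>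
          (\<forall>k\<in>I_G P xbar \<union> \<beta>1. \<mu> k \<noteq> 0 \<longrightarrow> \<mu> k * G_fun P k (xs s) > 0) \<and>
          (\<forall>k\<in>I_H P xbar \<union> \<beta>2. \<nu> k \<noteq> 0 \<longrightarrow> \<nu> k * H_fun P k (xs s) > 0))"

definition MPSC_PSOQN :: "'n::finite mpsc \<Rightarrow> real^'n \<Rightarrow> bool" where
  "MPSC_PSOQN P xbar \<longleftrightarrow>
     (\<forall>(\<beta>1, \<beta>2)\<in>bipartitions (I_GH P xbar).
        \<not> (\<exists>lam \<rho> \<mu> \<nu>.
             nonzero_multiplier P xbar \<beta>1 \<beta>2 lam \<rho> \<mu> \<nu> \<and>
             (\<forall>i\<in>{1..n_ineq P}. lam i \<ge> 0) \<and>
             stationary_multiplier P xbar \<beta>1 \<beta>2 lam \<rho> \<mu> \<nu> \<and>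
             (\<forall>d\<in>critical_subspace P xbar \<beta>1 \<beta>2.
                d \<bullet> (multiplier_hessian P xbar \<beta>1 \<beta>2 lam \<rho> \<mu> \<nu> *v d) \<ge> 0) \<and>
             (\<exists>xs. quasi_normality_sequence P xbar \<beta>1 \<beta>2 lam \<rho> \<mu> \<nu> xs)))"

definition penalty :: "'n::finite mpsc \<Rightarrow> real \<Rightarrow> real^'n \<Rightarrow> real" where
  "penalty P \<kappa> x =
     obj P x + \<kappa> * sqrt ((\<Sum>i=1..n_ineq P. (max (g_fun P i x) 0)\<^sup>2) +
                          (\<Sum>j=1..n_eq P. (h_fun P j x)\<^sup>2) +
                          (\<Sum>k=1..n_sw P. min ((G_fun P k x)\<^sup>2) ((H_fun P k x)\<^sup>2)))"

end

theory Submission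
  imports Defs
begin

text \<open>Near \<open>xbar\<close> every feasible point and every value of the penalty function belongs to one of
finitely many branches: a bipartition of the biactive switching indices decides which of the two
functions in each product is penalised, and the remaining switching constraints leave no choice.
Each branch is an ordinary nonlinear program for which \<open>xbar\<close> is locally optimal, and the penalty
function agrees at each point near \<open>xbar\<close> with the penalty function of some branch
(\<open>penalty_eq_branch_penalty_near\<close>).  Hence it suffices to prove exactness for every branch
and to take a threshold above those of all branches.

For one program with objective \<open>f\<close> and constraint violation \<open>V\<close> (the Euclidean norm of the residuals),
suppose exactness fails. Then there are points \<open>y n \<longlonglongrightarrow> xbar\<close> with \<open>f (y n) + n\<^sup>2 * V (y n) < f xbar\<close>. The
minimisers \<open>x n\<close> of \<open>f + n\<^sup>2 * V + n * norm (\<cdot> - y n)\<^sup>2\<close> over a small ball are infeasible, since their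
value lies below \<open>f xbar\<close>, and they converge to \<open>xbar\<close>, since the proximal weight \<open>n\<close> grows
(\<open>infeasible_penalised_minimisers\<close>). At an infeasible point \<open>V\<close> is smooth enough for necessary
conditions of first and second order (\<open>penalised_minimum_conditions\<close>), with the normalised residuals
as multipliers. Dividing by \<open>n\<^sup>2\<close> removes both the objective and the proximal term in the limit; a
subsequence of these unit multiplier vectors converges to a nonzero multiplier, whose sign conditions
are witnessed by the points \<open>x n\<close> themselves. The second-order inequality is available at \<open>x n\<close> only in
directions orthogonal to the active gradients at \<open>x n\<close>; the constant rank condition is what makes each
critical direction at \<open>xbar\<close> a limit of such directions (\<open>kernel_vector_approximation\<close>). The limit
multiplier therefore contradicts second-order quasi-normality
(\<open>exact_penalty_if_second_order_quasinormal\<close>).\<close>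

section \<open>Constraint violation\<close>

definition residual :: "bool \<Rightarrow> real \<Rightarrow> real" where
  "residual eq y = (if eq then y else max y 0)"

text \<open>The indices in \<open>E\<close> are those of equality constraints \<open>c i x = 0\<close>, the other ones belong to inequalities
\<open>c i x \<le> 0\<close>.\<close>

definition violation :: "'i set \<Rightarrow> 'i set \<Rightarrow> ('i \<Rightarrow> 'a \<Rightarrow> real) \<Rightarrow> 'a \<Rightarrow> real" where
  "violation E I c x = L2_set (\<lambda>i. residual (i \<in> E) (c i x)) I"

text \<open>The kink of the residual of an inequality at \<open>0\<close> disappears on squaring, so the squared violation of
smooth constraints is differentiable everywhere, whichever inequalities are active.\<close>

lemma residual_square_deriv:
  "((\<lambda>y. (residual e y)\<^sup>2) has_real_derivative 2 * residual e y) (at y)"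
proof (cases e)
  case True
  then show ?thesis
    by (auto simp: residual_def intro!: derivative_eq_intros)
next
  case False
  show ?thesis
  proof (cases "y = 0")
    case True
    have "((\<lambda>h::real. \<bar>h\<bar>) \<longlongrightarrow> 0) (at 0)"
      by (auto intro!: tendsto_eq_intros)
    then have "((\<lambda>h::real. (max h 0)\<^sup>2 / h) \<longlongrightarrow> 0) (at 0)"
    proof (rule Lim_null_comparison[rotated])
      show "\<forall>\<^sub>F h::real in at 0. norm ((max h 0)\<^sup>2 / h) \<le> \<bar>h\<bar>"
        by (intro always_eventually allI) (auto simp: max_def power2_eq_square)
    qed
    then show ?thesis
      using False True by (simp add: residual_def DERIV_def)
  next
    case y: False
    consider "y > 0" | "y < 0" using y by linarith
    then show ?thesis
    proof cases
      case 1
      have "((\<lambda>y. y\<^sup>2) has_real_derivative 2 * y) (at y)"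
        by (auto intro!: derivative_eq_intros)
      then have "((\<lambda>y. (residual e y)\<^sup>2) has_real_derivative 2 * y) (at y)"
        by (rule has_field_derivative_transform_within_open[of _ _ _ "{0<..}"])
           (use 1 False in \<open>auto simp: residual_def\<close>)
      then show ?thesis using 1 False by (simp add: residual_def)
    next
      case 2
      have "((\<lambda>y. 0) has_real_derivative 0) (at y)"
        by (auto intro!: derivative_eq_intros)
      then have "((\<lambda>y. (residual e y)\<^sup>2) has_real_derivative 0) (at y)"
        by (rule has_field_derivative_transform_within_open[of _ _ _ "{..<0}"])
           (use 2 False in \<open>auto simp: residual_def\<close>)
      then show ?thesis using 2 False by (simp add: residual_def)
    qed
  qed
qed

lemma continuous_residual [continuous_intros]:
  "continuous F f \<Longrightarrow> continuous F (\<lambda>x. residual e (f x))"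
  unfolding residual_def by (cases e) (auto intro!: continuous_intros)

lemma violation_nonneg: "0 \<le> violation E I c x"
  by (simp add: violation_def)

lemma violation_eq_0_iff:
  assumes "finite I"
  shows "violation E I c x = 0 \<longleftrightarrow> (\<forall>i\<in>I. if i \<in> E then c i x = 0 else c i x \<le> 0)"
proof -
  have "residual e y = 0 \<longleftrightarrow> (if e then y = 0 else y \<le> 0)" for e y
    by (auto simp: residual_def)
  then show ?thesis
    unfolding violation_def L2_set_eq_0_iff[OF assms] by metis
qed

lemma isCont_violation:
  fixes c :: "'i \<Rightarrow> 'a::t2_space \<Rightarrow> real"
  assumes "\<And>i. i \<in> I \<Longrightarrow> isCont (c i) x"
  shows "isCont (violation E I c) x"
  unfolding violation_def L2_set_def
  by (intro continuous_intros assms)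

lemma violation_sum_squares:
  "(violation E I c x)\<^sup>2 = (\<Sum>i\<in>I. (residual (i \<in> E) (c i x))\<^sup>2)"
  unfolding violation_def L2_set_def by (simp add: sum_nonneg)

section \<open>Second-order calculus along lines\<close>

lemma has_derivative_grad:
  assumes "twice_cont_diff f"
  shows "(f has_derivative (\<lambda>h. h \<bullet> grad f x)) (at x)"
  using GDERIV_grad[of f x] assms by (simp add: twice_cont_diff_def gderiv_def)

lemma isCont_twice_cont_diff: "twice_cont_diff f \<Longrightarrow> isCont f x"
  using has_derivative_grad has_derivative_continuous by blast

lemma isCont_grad: "twice_cont_diff f \<Longrightarrow> isCont (grad f) x"
  by (simp add: twice_cont_diff_def differentiable_imp_continuous_within)

lemma isCont_hessian: "twice_cont_diff f \<Longrightarrow> isCont (hessian f) x"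
  by (simp add: twice_cont_diff_def continuous_on_eq_continuous_at)

lemma tendsto_hessian_quadratic_form:
  assumes f: "twice_cont_diff f" and x: "(x \<longlongrightarrow> a) F" and d: "(d \<longlongrightarrow> e) F"
  shows "((\<lambda>s. d s \<bullet> (hessian f (x s) *v d s)) \<longlongrightarrow> e \<bullet> (hessian f a *v e)) F"
proof -
  have "((\<lambda>s. hessian f (x s)) \<longlongrightarrow> hessian f a) F"
    by (rule isCont_tendsto_compose[OF isCont_hessian[OF f] x])
  then have "((\<lambda>s. hessian f (x s) *v d s) \<longlongrightarrow> hessian f a *v e) F"
    using d unfolding matrix_vector_mult_def
    by (intro tendsto_vec_lambda tendsto_intros) auto
  then show ?thesis using d by (intro tendsto_intros)
qed

lemma isCont_iff_tendsto_nhds: "isCont f x \<longleftrightarrow> (f \<longlongrightarrow> f x) (nhds x)"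
  by (simp add: isCont_def tendsto_at_iff_tendsto_nhds)

lemma DERIV_along_line:
  assumes "twice_cont_diff f"
  shows "((\<lambda>t. f (x + t *\<^sub>R d)) has_real_derivative grad f (x + t *\<^sub>R d) \<bullet> d) (at t)"
proof -
  have "((\<lambda>t. x + t *\<^sub>R d) has_derivative (\<lambda>h. h *\<^sub>R d)) (at t)"
    by (auto intro!: derivative_eq_intros)
  from has_derivative_compose[OF this has_derivative_grad[OF assms]]
  show ?thesis
    unfolding has_field_derivative_def
    by (rule has_derivative_eq_rhs) (auto simp: fun_eq_iff inner_commute)
qed

lemma DERIV_grad_along_line:
  assumes "twice_cont_diff f"
  shows "((\<lambda>t. grad f (x + t *\<^sub>R d) \<bullet> d) has_real_derivative d \<bullet> (hessian f x *v d)) (at 0)"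
proof -
  have l: "((\<lambda>t. x + t *\<^sub>R d) has_derivative (\<lambda>h. h *\<^sub>R d)) (at 0)"
    by (auto intro!: derivative_eq_intros)
  have "(grad f has_derivative (\<lambda>h. hessian f x *v h)) (at (x + 0 *\<^sub>R d))"
    using assms unfolding hessian_def twice_cont_diff_def
    by (simp add: jacobian_works[symmetric])
  from has_derivative_compose[OF l this]
  have "((\<lambda>t. grad f (x + t *\<^sub>R d)) has_derivative (\<lambda>h. hessian f x *v (h *\<^sub>R d))) (at 0)" .
  from has_derivative_inner_left[OF this, of d]
  show ?thesis
    unfolding has_field_derivative_def
    by (rule has_derivative_eq_rhs)
       (auto simp: fun_eq_iff inner_commute matrix_vector_mult_scaleR)
qed

text \<open>Where \<open>q\<close> vanishes the product rule needs only continuity of \<open>p\<close>. This takes a second derivative of the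
violation although the residuals of inequalities are not differentiable at \<open>0\<close>.\<close>

lemma DERIV_mult_vanishing:
  fixes p q :: "real \<Rightarrow> real"
  assumes "isCont p a" and "(q has_real_derivative D) (at a)" and "q a = 0"
  shows "((\<lambda>t. p t * q t) has_real_derivative p a * D) (at a)"
proof -
  obtain s where s: "\<And>z. q z - q a = s z * (z - a)" "isCont s a" "s a = D"
    using assms(2) unfolding CARAT_DERIV by blast
  have "isCont (\<lambda>t. p t * s t) a"
    using assms(1) s(2) by (intro continuous_intros)
  moreover have "p z * q z - p a * q a = p z * s z * (z - a)" for z
    using s(1)[of z] assms(3) by simp
  ultimately show ?thesis
    unfolding CARAT_DERIV using s(3) by (intro exI[of _ "\<lambda>t. p t * s t"]) auto
qed

text \<open>A negative second derivative would make \<open>\<phi>\<close> strictly decreasing immediately to the right of the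
minimum.\<close>

lemma second_derivative_nonneg_at_local_min:
  fixes \<phi> \<phi>' :: "real \<Rightarrow> real"
  assumes "\<epsilon> > 0"
    and min: "\<And>t. \<bar>t - a\<bar> < \<epsilon> \<Longrightarrow> \<phi> a \<le> \<phi> t"
    and der: "\<And>t. \<bar>t - a\<bar> < \<epsilon> \<Longrightarrow> (\<phi> has_real_derivative \<phi>' t) (at t)"
    and der2: "(\<phi>' has_real_derivative L) (at a)"
  shows "0 \<le> L"
proof (rule ccontr)
  assume "\<not> 0 \<le> L"
  then obtain \<delta> where \<delta>: "\<delta> > 0" "\<And>h. 0 < h \<Longrightarrow> h < \<delta> \<Longrightarrow> \<phi>' (a + h) < \<phi>' a"
    using DERIV_neg_dec_right[OF der2] by auto
  have z: "\<phi>' a = 0"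
    by (rule DERIV_local_min[of \<phi> _ a \<epsilon>])
       (use assms der[of a] min in \<open>auto simp: abs_minus_commute\<close>)
  define h where "h = min \<delta> \<epsilon> / 2"
  have h: "0 < h" "h < \<delta>" "h < \<epsilon>" using \<delta>(1) \<open>\<epsilon> > 0\<close> by (auto simp: h_def)
  have "\<exists>\<xi>>a. \<xi> < a + h \<and> \<phi> (a + h) - \<phi> a = (a + h - a) * \<phi>' \<xi>"
    using h by (intro MVT2 der) auto
  then obtain \<xi> where \<xi>: "a < \<xi>" "\<xi> < a + h" "\<phi> (a + h) - \<phi> a = h * \<phi>' \<xi>" by auto
  have "\<phi>' \<xi> < 0" using \<delta>(2)[of "\<xi> - a"] \<xi> h z by auto
  then have "h * \<phi>' \<xi> < 0" using h(1) by (simp add: mult_pos_neg)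
  with \<xi>(3) min[of "a + h"] h show False by auto
qed

section \<open>Necessary conditions at infeasible penalised minimisers\<close>

text \<open>Both conditions come from restricting the penalised function to lines through \<open>x\<close>. Because \<open>V\<close> is
positive at \<open>x\<close>, its derivative along a line is the residual-weighted sum of the slopes of the constraints divided
by \<open>V\<close>. In a direction annihilated by all relevant gradients every summand has a vanishing slope at \<open>x\<close>,
so the derivatives of the residuals and of the factor \<open>1 / V\<close> drop out of the second derivative and only
the Hessians of the constraints remain. A strictly satisfied inequality has zero residual
near \<open>x\<close> and imposes no restriction on the direction.\<close>

lemma penalised_minimum_conditions:
  fixes c :: "'i \<Rightarrow> real^'n \<Rightarrow> real"
  assumes c: "\<And>i. i \<in> I \<Longrightarrow> twice_cont_diff (c i)" and f: "twice_cont_diff f"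
    and pos: "violation E I c x > 0"
    and min: "\<forall>\<^sub>F z in nhds x. f x + \<kappa> * violation E I c x + M * (norm (x - y))\<^sup>2
        \<le> f z + \<kappa> * violation E I c z + M * (norm (z - y))\<^sup>2"
  defines "u \<equiv> \<lambda>i. residual (i \<in> E) (c i x) / violation E I c x"
  shows "grad f x + \<kappa> *\<^sub>R (\<Sum>i\<in>I. u i *\<^sub>R grad (c i) x) + (2 * M) *\<^sub>R (x - y) = 0" (is ?first)
    and "\<And>d. (\<And>i. i \<in> I \<Longrightarrow> grad (c i) x \<bullet> d = 0 \<or> i \<notin> E \<and> c i x < 0) \<Longrightarrow>
      0 \<le> d \<bullet> (hessian f x *v d) + \<kappa> * (\<Sum>i\<in>I. u i * (d \<bullet> (hessian (c i) x *v d)))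
        + 2 * M * (d \<bullet> d)"
proof -
  define V where "V = violation E I c"
  define r where "r = (\<lambda>i z. residual (i \<in> E) (c i z))"
  have cont_c: "isCont (c i) z" if "i \<in> I" for i z
    by (rule isCont_twice_cont_diff[OF c[OF that]])
  have cont_V: "isCont V z" for z
    unfolding V_def by (rule isCont_violation[OF cont_c])
  have Vx: "V x > 0" using pos by (simp add: V_def)
  \<comment> \<open>\<open>D d\<close> will be the derivative of \<open>\<psi>\<close> along the line through \<open>x\<close> in direction \<open>d\<close>.\<close>
  define \<psi> where "\<psi> = (\<lambda>z. f z + \<kappa> * V z + M * (norm (z - y))\<^sup>2)"
  define S where "S = (\<lambda>d t. \<Sum>i\<in>I. r i (x + t *\<^sub>R d) * (grad (c i) (x + t *\<^sub>R d) \<bullet> d))"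
  define D where "D = (\<lambda>d t. grad f (x + t *\<^sub>R d) \<bullet> d + \<kappa> * (inverse (V (x + t *\<^sub>R d)) * S d t)
      + 2 * M * ((x + t *\<^sub>R d - y) \<bullet> d))"
  have derV: "((\<lambda>t. V (x + t *\<^sub>R d)) has_real_derivative
      inverse (V (x + t *\<^sub>R d)) * S d t) (at t)"
    if "V (x + t *\<^sub>R d) > 0" for d t
  proof -
    have "((\<lambda>t. (r i (x + t *\<^sub>R d))\<^sup>2) has_real_derivative
        2 * r i (x + t *\<^sub>R d) * (grad (c i) (x + t *\<^sub>R d) \<bullet> d)) (at t)" if "i \<in> I" for i
      unfolding r_def
      by (rule DERIV_chain2[OF residual_square_deriv DERIV_along_line[OF c[OF that]]])
    then have "((\<lambda>t. \<Sum>i\<in>I. (r i (x + t *\<^sub>R d))\<^sup>2) has_real_derivative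
        (\<Sum>i\<in>I. 2 * r i (x + t *\<^sub>R d) * (grad (c i) (x + t *\<^sub>R d) \<bullet> d))) (at t)"
      by (rule DERIV_sum)
    also have "(\<Sum>i\<in>I. 2 * r i (x + t *\<^sub>R d) * (grad (c i) (x + t *\<^sub>R d) \<bullet> d)) = 2 * S d t"
      by (simp add: S_def sum_distrib_left mult.assoc)
    finally have 1: "((\<lambda>t. \<Sum>i\<in>I. (r i (x + t *\<^sub>R d))\<^sup>2) has_real_derivative 2 * S d t) (at t)" .
    have eq: "(\<Sum>i\<in>I. (r i z)\<^sup>2) = (V z)\<^sup>2" for z
      by (simp add: V_def r_def violation_sum_squares)
    have "((\<lambda>t. sqrt ((V (x + t *\<^sub>R d))\<^sup>2)) has_real_derivative
        inverse (sqrt ((V (x + t *\<^sub>R d))\<^sup>2)) / 2 * (2 * S d t)) (at t)"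
      using that 1[unfolded eq] by (intro DERIV_chain2[OF DERIV_real_sqrt]) auto
    then show ?thesis
      by (simp add: V_def violation_nonneg)
  qed
  have cont_line: "isCont (\<lambda>t. x + t *\<^sub>R d) t" for d and t :: real
    by (intro continuous_intros)
  have der\<psi>: "((\<lambda>t. \<psi> (x + t *\<^sub>R d)) has_real_derivative D d t) (at t)"
    if "V (x + t *\<^sub>R d) > 0" for d t
  proof -
    have "((\<lambda>t. (norm (x + t *\<^sub>R d - y))\<^sup>2) has_real_derivative
         2 * ((x + t *\<^sub>R d - y) \<bullet> d)) (at t)"
      unfolding power2_norm_eq_inner has_field_derivative_def
      by (rule has_derivative_eq_rhs, (rule derivative_eq_intros refl)+)
         (auto simp: fun_eq_iff inner_commute algebra_simps)
    from DERIV_add[OF DERIV_add[OF DERIV_along_line[OF f]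
        DERIV_cmult[OF derV[OF that], of \<kappa>]] DERIV_cmult[OF this, of M]]
    show ?thesis unfolding \<psi>_def D_def by (simp add: mult.assoc mult.left_commute)
  qed
  have near: "\<exists>\<epsilon>>0. \<forall>t. \<bar>t\<bar> < \<epsilon> \<longrightarrow> \<psi> x \<le> \<psi> (x + t *\<^sub>R d) \<and> V (x + t *\<^sub>R d) > 0" for d
  proof -
    have "\<forall>\<^sub>F z in nhds x. V z > 0"
      using order_tendstoD(1)[OF cont_V[of x, unfolded isCont_iff_tendsto_nhds]] Vx by blast
    with min have ev: "\<forall>\<^sub>F z in nhds x. \<psi> x \<le> \<psi> z \<and> V z > 0"
      unfolding \<psi>_def V_def by eventually_elim auto
    have "filterlim (\<lambda>t. x + t *\<^sub>R d) (nhds x) (nhds 0)"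
      using isCont_iff_tendsto_nhds[THEN iffD1, OF cont_line[where d = d and t = 0]] by simp
    from eventually_compose_filterlim[OF ev this] show ?thesis
      by (auto simp: eventually_nhds_metric dist_real_def)
  qed
  have D0: "D d 0 = (grad f x + \<kappa> *\<^sub>R (\<Sum>i\<in>I. u i *\<^sub>R grad (c i) x) + (2 * M) *\<^sub>R (x - y)) \<bullet> d" for d
    by (simp add: D_def S_def u_def V_def r_def inner_add_left inner_sum_left
        sum_distrib_left divide_inverse mult_ac)
  have "D d 0 = 0" for d
  proof -
    obtain \<epsilon> where \<epsilon>: "\<epsilon> > 0" "\<And>t. \<bar>t\<bar> < \<epsilon> \<Longrightarrow> \<psi> x \<le> \<psi> (x + t *\<^sub>R d)"
      using near by blast
    show ?thesis
      by (rule DERIV_local_min[OF der\<psi>[where d = d and t = 0], of \<epsilon>]) (use \<epsilon> Vx in auto)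
  qed
  then show ?first
    unfolding D0 using inner_eq_zero_iff by blast
  fix d
  assume d: "\<And>i. i \<in> I \<Longrightarrow> grad (c i) x \<bullet> d = 0 \<or> i \<notin> E \<and> c i x < 0"
  obtain \<epsilon> where \<epsilon>: "\<epsilon> > 0" "\<And>t. \<bar>t\<bar> < \<epsilon> \<Longrightarrow> \<psi> x \<le> \<psi> (x + t *\<^sub>R d) \<and> V (x + t *\<^sub>R d) > 0"
    using near by blast
  have "((\<lambda>t. r i (x + t *\<^sub>R d) * (grad (c i) (x + t *\<^sub>R d) \<bullet> d)) has_real_derivative
      r i x * (d \<bullet> (hessian (c i) x *v d))) (at 0)" if i: "i \<in> I" for i
  proof (cases "grad (c i) x \<bullet> d = 0")
    case True
    have "isCont (\<lambda>t. r i (x + t *\<^sub>R d)) 0"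
      unfolding r_def
      by (rule isCont_o2[OF cont_line]) (auto intro!: continuous_intros cont_c[OF i])
    from DERIV_mult_vanishing[OF this DERIV_grad_along_line[OF c[OF i]]] True
    show ?thesis by simp
  next
    case False
    with d[OF i] have neg: "i \<notin> E" "c i x < 0" by auto
    have "isCont (\<lambda>t. c i (x + t *\<^sub>R d)) 0"
      by (rule isCont_o2[OF cont_line cont_c[OF i]])
    then have "\<forall>\<^sub>F t in nhds 0. c i (x + t *\<^sub>R d) < 0"
      unfolding isCont_iff_tendsto_nhds using neg(2) order_tendstoD(2) by fastforce
    then have ev: "\<forall>\<^sub>F t in nhds 0. r i (x + t *\<^sub>R d) * (grad (c i) (x + t *\<^sub>R d) \<bullet> d) = 0"
      by eventually_elim (use neg in \<open>auto simp: r_def residual_def\<close>)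
    have "r i x = 0" using neg by (simp add: r_def residual_def)
    then show ?thesis
      using DERIV_cong_ev[OF refl ev refl, THEN iffD2] by simp
  qed
  then have "(S d has_real_derivative (\<Sum>i\<in>I. r i x * (d \<bullet> (hessian (c i) x *v d)))) (at 0)"
    unfolding S_def by (rule DERIV_sum)
  moreover have "isCont (\<lambda>t. inverse (V (x + t *\<^sub>R d))) 0"
    using isCont_o2[OF cont_line[where d = d and t = 0] cont_V] Vx by (intro continuous_intros) auto
  moreover have "r i x * (grad (c i) x \<bullet> d) = 0" if "i \<in> I" for i
    using d[OF that] by (auto simp: r_def residual_def)
  then have "S d 0 = 0" by (auto simp: S_def intro!: sum.neutral)
  ultimately have "((\<lambda>t. inverse (V (x + t *\<^sub>R d)) * S d t) has_real_derivative
      inverse (V x) * (\<Sum>i\<in>I. r i x * (d \<bullet> (hessian (c i) x *v d)))) (at 0)"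
    using DERIV_mult_vanishing[where p = "\<lambda>t. inverse (V (x + t *\<^sub>R d))" and q = "S d" and a = 0]
    by simp
  then have "((\<lambda>t. inverse (V (x + t *\<^sub>R d)) * S d t) has_real_derivative
      (\<Sum>i\<in>I. u i * (d \<bullet> (hessian (c i) x *v d)))) (at 0)"
    by (simp add: u_def V_def r_def sum_distrib_left divide_inverse mult_ac)
  moreover have "((\<lambda>t. (x + t *\<^sub>R d - y) \<bullet> d) has_real_derivative d \<bullet> d) (at 0)"
    unfolding has_field_derivative_def
    by (rule has_derivative_eq_rhs, (rule derivative_eq_intros refl)+)
       (auto simp: fun_eq_iff)
  ultimately have "(D d has_real_derivative
      d \<bullet> (hessian f x *v d) + \<kappa> * (\<Sum>i\<in>I. u i * (d \<bullet> (hessian (c i) x *v d)))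
        + 2 * M * (d \<bullet> d)) (at 0)"
    unfolding D_def
    by (intro DERIV_add DERIV_cmult DERIV_grad_along_line[OF f])
  with \<epsilon> show "0 \<le> d \<bullet> (hessian f x *v d)
      + \<kappa> * (\<Sum>i\<in>I. u i * (d \<bullet> (hessian (c i) x *v d))) + 2 * M * (d \<bullet> d)"
    using second_derivative_nonneg_at_local_min[of \<epsilon> 0 "\<lambda>t. \<psi> (x + t *\<^sub>R d)" "D d"] der\<psi>
    by simp
qed

section \<open>Kernels of families of constant rank\<close>

lemma dual_vectors_exist:
  fixes v :: "'i \<Rightarrow> 'a::euclidean_space"
  assumes "independent (v ` B)" "inj_on v B"
  shows "\<exists>w. \<forall>i\<in>B. \<forall>j\<in>B. v i \<bullet> w j = (if i = j then 1 else 0)"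
proof -
  have "\<exists>w. \<forall>i\<in>B. v i \<bullet> w = (if i = j then 1 else 0)" if "j \<in> B" for j
  proof -
    obtain \<phi> :: "'a \<Rightarrow> real" where lin: "linear \<phi>"
      and \<phi>: "\<forall>z\<in>v ` B. \<phi> z = (if z = v j then 1 else 0)"
      using linear_independent_extend[OF assms(1), of "\<lambda>z. if z = v j then 1 else (0::real)"]
      by blast
    have "z \<bullet> (\<Sum>b\<in>Basis. \<phi> b *\<^sub>R b) = \<phi> z" for z
    proof -
      have "\<phi> z = \<phi> (\<Sum>b\<in>Basis. (z \<bullet> b) *\<^sub>R b)" by (simp add: euclidean_representation)
      also have "\<dots> = z \<bullet> (\<Sum>b\<in>Basis. \<phi> b *\<^sub>R b)"
        by (simp add: linear_sum[OF lin] linear_cmul[OF lin] inner_sum_right mult.commute)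
      finally show ?thesis ..
    qed
    then show ?thesis
      using \<phi> inj_onD[OF assms(2)] that by (intro exI[of _ "\<Sum>b\<in>Basis. \<phi> b *\<^sub>R b"]) auto
  qed
  then show ?thesis by metis
qed

text \<open>Linear independence is stable under perturbation, with uniformly bounded coefficients: pairing a
combination of the perturbed vectors with the dual vectors \<open>w\<close> of the limit family returns its
coefficients up to errors that are small multiples of the sum of their absolute values.\<close>

lemma eventually_coefficients_bounded:
  fixes v :: "'i \<Rightarrow> 's \<Rightarrow> 'a::euclidean_space"
  assumes fin: "finite B" and ind: "independent (v0 ` B)" "inj_on v0 B"
    and lim: "\<And>i. i \<in> B \<Longrightarrow> (v i \<longlongrightarrow> v0 i) F"
  shows "\<exists>C\<ge>0. \<forall>\<^sub>F s in F. \<forall>a. (\<Sum>i\<in>B. \<bar>a i\<bar>) \<le> C * norm (\<Sum>i\<in>B. a i *\<^sub>R v i s)"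
proof -
  obtain w where w: "\<And>i j. i \<in> B \<Longrightarrow> j \<in> B \<Longrightarrow> v0 i \<bullet> w j = (if i = j then 1 else 0)"
    using dual_vectors_exist[OF ind] by blast
  \<comment> \<open>Chosen so that the \<open>card B\<close> errors add up to at most half of the sum \<open>T\<close> below.\<close>
  define \<epsilon> where "\<epsilon> = 1 / (2 * (real (card B) + 1))"
  have "\<epsilon> > 0" by (simp add: \<epsilon>_def add_nonneg_pos)
  have "\<forall>\<^sub>F s in F. \<bar>v i s \<bullet> w j - (if i = j then 1 else 0)\<bar> < \<epsilon>" if "i \<in> B" "j \<in> B" for i j
  proof -
    have "((\<lambda>s. v i s \<bullet> w j) \<longlongrightarrow> (if i = j then 1 else 0)) F"
      using tendsto_inner[OF lim[OF that(1)] tendsto_const, of "w j"] w[OF that] by simp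
    from tendstoD[OF this \<open>\<epsilon> > 0\<close>] show ?thesis by (simp add: dist_real_def)
  qed
  then have "\<forall>\<^sub>F s in F. \<forall>i\<in>B. \<forall>j\<in>B. \<bar>v i s \<bullet> w j - (if i = j then 1 else 0)\<bar> < \<epsilon>"
    by (simp add: eventually_ball_finite_distrib fin)
  then have "\<forall>\<^sub>F s in F. \<forall>a. (\<Sum>i\<in>B. \<bar>a i\<bar>)
      \<le> (2 * (\<Sum>j\<in>B. norm (w j))) * norm (\<Sum>i\<in>B. a i *\<^sub>R v i s)"
  proof (rule eventually_mono, intro allI)
    fix s and a :: "'i \<Rightarrow> real"
    assume e: "\<forall>i\<in>B. \<forall>j\<in>B. \<bar>v i s \<bullet> w j - (if i = j then 1 else 0)\<bar> < \<epsilon>"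
    define p where "p = (\<Sum>i\<in>B. a i *\<^sub>R v i s)"
    define T where "T = (\<Sum>i\<in>B. \<bar>a i\<bar>)"
    have "T \<ge> 0" by (simp add: T_def sum_nonneg)
    have "\<bar>a j\<bar> \<le> norm p * norm (w j) + T * \<epsilon>" if j: "j \<in> B" for j
    proof -
      have "(\<Sum>i\<in>B. a i * (v i s \<bullet> w j - (if i = j then 1 else 0)))
          = p \<bullet> w j - (\<Sum>i\<in>B. if i = j then a i else 0)"
        unfolding p_def inner_sum_left sum_subtractf[symmetric]
        by (rule sum.cong) (auto simp: algebra_simps)
      also have "(\<Sum>i\<in>B. if i = j then a i else 0) = a j"
        using fin j by simp
      finally have "a j = p \<bullet> w j - (\<Sum>i\<in>B. a i * (v i s \<bullet> w j - (if i = j then 1 else 0)))"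
        by simp
      then have "\<bar>a j\<bar> \<le> \<bar>p \<bullet> w j\<bar> + \<bar>\<Sum>i\<in>B. a i * (v i s \<bullet> w j - (if i = j then 1 else 0))\<bar>"
        by linarith
      also have "\<bar>p \<bullet> w j\<bar> \<le> norm p * norm (w j)" by (rule Cauchy_Schwarz_ineq2)
      also have "\<bar>\<Sum>i\<in>B. a i * (v i s \<bullet> w j - (if i = j then 1 else 0))\<bar> \<le> T * \<epsilon>"
        unfolding T_def sum_distrib_right
        by (rule order_trans[OF sum_abs sum_mono])
           (use e j in \<open>simp add: abs_mult mult_left_mono less_imp_le\<close>)
      finally show ?thesis by simp
    qed
    then have "T \<le> (\<Sum>j\<in>B. norm p * norm (w j) + T * \<epsilon>)"
      unfolding T_def by (rule sum_mono)
    also have "\<dots> = norm p * (\<Sum>j\<in>B. norm (w j)) + T * (card B * \<epsilon>)"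
      by (simp add: sum.distrib sum_distrib_left)
    also have "card B * \<epsilon> \<le> 1 / 2"
      by (simp add: \<epsilon>_def field_simps)
    then have "T * (card B * \<epsilon>) \<le> T * (1 / 2)"
      using \<open>T \<ge> 0\<close> by (rule mult_left_mono)
    finally show "T \<le> (2 * (\<Sum>j\<in>B. norm (w j))) * norm p"
      by (simp add: mult.commute mult.left_commute)
  qed
  moreover have "0 \<le> 2 * (\<Sum>j\<in>B. norm (w j))" by (simp add: sum_nonneg)
  ultimately show ?thesis by blast
qed

lemma independent_image_if_coefficients_bounded:
  fixes v :: "'i \<Rightarrow> 'a::euclidean_space"
  assumes fin: "finite B"
    and bound: "\<And>a. (\<Sum>i\<in>B. \<bar>a i\<bar>) \<le> C * norm (\<Sum>i\<in>B. a i *\<^sub>R v i)"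
  shows "inj_on v B" "independent (v ` B)"
proof -
  have zero: "a i = 0" if "(\<Sum>i\<in>B. a i *\<^sub>R v i) = 0" "i \<in> B" for a i
  proof -
    have "(\<Sum>i\<in>B. \<bar>a i\<bar>) \<le> 0" using bound[of a] that(1) by simp
    then have "(\<Sum>i\<in>B. \<bar>a i\<bar>) = 0" using sum_nonneg[of B "\<lambda>i. \<bar>a i\<bar>"] by linarith
    then show ?thesis using fin that(2) by (simp add: sum_nonneg_eq_0_iff)
  qed
  show inj: "inj_on v B"
  proof (rule inj_onI, rule ccontr)
    fix i j assume ij: "i \<in> B" "j \<in> B" "v i = v j" "i \<noteq> j"
    define a where "a = (\<lambda>k. (if k = i then 1 else 0) - (if k = j then 1 else (0::real)))"
    have "(\<Sum>k\<in>B. a k *\<^sub>R v k)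
        = (\<Sum>k\<in>B. if k = i then v k else 0) - (\<Sum>k\<in>B. if k = j then v k else 0)"
      unfolding sum_subtractf[symmetric] by (rule sum.cong) (auto simp: a_def)
    also have "\<dots> = 0" using ij fin by simp
    finally show False using zero[of a i] ij by (simp add: a_def)
  qed
  show "independent (v ` B)"
  proof (rule independent_if_scalars_zero)
    fix b z assume "(\<Sum>z\<in>v ` B. b z *\<^sub>R z) = 0" "z \<in> v ` B"
    then show "b z = 0"
      using zero[of "b \<circ> v"] by (auto simp: sum.reindex[OF inj])
  qed (use fin in simp)
qed

text \<open>Orthogonality to a family of vectors varies continuously when the rank does not jump. A basis chosen from the limit
family stays independent, and by constant rank it still spans the perturbed family. The component \<open>p\<close> of
\<open>d\<close> in that span is therefore a combination of basis vectors with coefficients bounded by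
a multiple of the norm of \<open>p\<close>, so that \<open>p \<bullet> p = p \<bullet> d\<close> bounds this norm by the inner products of \<open>d\<close> with
the perturbed basis vectors, which tend to \<open>0\<close>. The approximating vector is \<open>d - p\<close>.\<close>

lemma kernel_vector_approximation:
  fixes v :: "'i \<Rightarrow> 's \<Rightarrow> 'a::euclidean_space"
  assumes fin: "finite A"
    and lim: "\<And>i. i \<in> A \<Longrightarrow> (v i \<longlongrightarrow> v0 i) F"
    and rank: "\<forall>\<^sub>F s in F. dim ((\<lambda>i. v i s) ` A) = dim (v0 ` A)"
    and d: "\<And>i. i \<in> A \<Longrightarrow> v0 i \<bullet> d = 0"
  shows "\<exists>d'. (d' \<longlongrightarrow> d) F \<and> (\<forall>s. \<forall>i\<in>A. v i s \<bullet> d' s = 0)"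
proof -
  obtain B where B: "B \<subseteq> A" "inj_on v0 B" "independent (v0 ` B)" "card (v0 ` B) = dim (v0 ` A)"
    by (metis basis_exists[of "v0 ` A"] subset_image_inj)
  have finB: "finite B" using B(1) fin finite_subset by blast
  have "\<exists>p q. p \<in> span ((\<lambda>i. v i s) ` A) \<and> (\<forall>i\<in>A. v i s \<bullet> q = 0) \<and> p \<bullet> q = 0 \<and> d = p + q" for s
  proof -
    obtain p q where pq: "p \<in> span ((\<lambda>i. v i s) ` A)"
      "\<And>w. w \<in> span ((\<lambda>i. v i s) ` A) \<Longrightarrow> orthogonal q w" "d = p + q"
      using orthogonal_subspace_decomp_exists[of "(\<lambda>i. v i s) ` A" d] by blast
    have "z \<bullet> q = 0" if "z \<in> span ((\<lambda>i. v i s) ` A)" for z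
      using pq(2)[OF that] by (simp add: orthogonal_def inner_commute)
    with pq(1,3) show ?thesis
      by (intro exI[of _ p] exI[of _ q]) (simp add: span_base)
  qed
  then obtain p q where p: "\<And>s. p s \<in> span ((\<lambda>i. v i s) ` A)"
    and q: "\<And>s i. i \<in> A \<Longrightarrow> v i s \<bullet> q s = 0"
    and pq: "\<And>s. p s \<bullet> q s = 0" "\<And>s. d = p s + q s"
    by metis
  obtain C where "C \<ge> 0" and C: "\<forall>\<^sub>F s in F. \<forall>a. (\<Sum>i\<in>B. \<bar>a i\<bar>) \<le> C * norm (\<Sum>i\<in>B. a i *\<^sub>R v i s)"
    using eventually_coefficients_bounded[OF finB B(3,2), of v F] lim B(1) by blast
  define R where "R = (\<lambda>s. \<Sum>i\<in>B. \<bar>v i s \<bullet> d\<bar>)"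
  have "(R \<longlongrightarrow> (\<Sum>i\<in>B. \<bar>v0 i \<bullet> d\<bar>)) F"
    unfolding R_def using lim B(1) by (intro tendsto_intros) auto
  moreover have "(\<Sum>i\<in>B. \<bar>v0 i \<bullet> d\<bar>) = 0"
    using d B(1) by (intro sum.neutral) auto
  ultimately have R: "((\<lambda>s. C * R s) \<longlongrightarrow> 0) F"
    using tendsto_mult_right_zero by fastforce
  have "\<forall>\<^sub>F s in F. norm (p s) \<le> C * R s"
    using C rank
  proof eventually_elim
    fix s
    assume bound: "\<forall>a. (\<Sum>i\<in>B. \<bar>a i\<bar>) \<le> C * norm (\<Sum>i\<in>B. a i *\<^sub>R v i s)"
      and rank: "dim ((\<lambda>i. v i s) ` A) = dim (v0 ` A)"
    note ind = independent_image_if_coefficients_bounded[OF finB, of C "\<lambda>i. v i s"]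
    have inj: "inj_on (\<lambda>i. v i s) B" and indep: "independent ((\<lambda>i. v i s) ` B)"
      using ind bound by blast+
    have "dim ((\<lambda>i. v i s) ` A) \<le> card ((\<lambda>i. v i s) ` B)"
      using rank B(2,4) inj by (simp add: card_image)
    from card_ge_dim_independent[OF image_mono[OF B(1)] indep this]
    have "p s \<in> span ((\<lambda>i. v i s) ` B)"
      using p[of s] span_mono span_span by blast
    then obtain b where "p s = (\<Sum>z\<in>(\<lambda>i. v i s) ` B. b z *\<^sub>R z)"
      using finB by (auto simp: span_finite)
    then have ps: "p s = (\<Sum>i\<in>B. b (v i s) *\<^sub>R v i s)"
      by (simp add: sum.reindex[OF inj])
    have "(norm (p s))\<^sup>2 = p s \<bullet> d"
      using pq[of s] by (simp add: power2_norm_eq_inner inner_add_right)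
    also have "\<dots> = (\<Sum>i\<in>B. b (v i s) * (v i s \<bullet> d))"
      by (subst ps) (simp add: inner_sum_left)
    also have "\<dots> \<le> (\<Sum>i\<in>B. \<bar>b (v i s)\<bar> * R s)"
    proof (rule sum_mono)
      fix i assume "i \<in> B"
      then have "\<bar>v i s \<bullet> d\<bar> \<le> R s"
        unfolding R_def using finB by (intro member_le_sum) auto
      then show "b (v i s) * (v i s \<bullet> d) \<le> \<bar>b (v i s)\<bar> * R s"
        by (metis abs_ge_self abs_ge_zero abs_mult mult_left_mono order_trans)
    qed
    also have "\<dots> = (\<Sum>i\<in>B. \<bar>b (v i s)\<bar>) * R s" by (simp add: sum_distrib_right)
    also have "\<dots> \<le> (C * norm (p s)) * R s"
      using bound[rule_format, of "\<lambda>i. b (v i s)"] ps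
      by (intro mult_right_mono) (auto simp: R_def sum_nonneg)
    finally have "norm (p s) * norm (p s) \<le> norm (p s) * (C * R s)"
      by (simp add: power2_eq_square mult_ac)
    moreover have "0 \<le> C * R s"
      using \<open>C \<ge> 0\<close> by (simp add: R_def sum_nonneg)
    ultimately show "norm (p s) \<le> C * R s"
      by (cases "p s = 0") auto
  qed
  then have "(p \<longlongrightarrow> 0) F"
    by (rule Lim_null_comparison) (rule R)
  then have "((\<lambda>s. d - p s) \<longlongrightarrow> d) F"
    using tendsto_diff[OF tendsto_const, of p 0 F d] by simp
  moreover have "(\<lambda>s. d - p s) = q" using pq(2) by (metis add_diff_cancel_left' ext)
  ultimately show ?thesis using q by auto
qed

section \<open>Exact penalisation of a nonlinear program\<close>

lemma common_convergent_subsequence: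
  fixes u :: "nat \<Rightarrow> 'i \<Rightarrow> 'a::heine_borel"
  assumes "finite I" and "\<And>i. i \<in> I \<Longrightarrow> bounded (range (\<lambda>n. u n i))"
  shows "\<exists>r l. strict_mono (r :: nat \<Rightarrow> nat) \<and> (\<forall>i\<in>I. (\<lambda>n. u (r n) i) \<longlonglongrightarrow> l i)"
  using assms
proof (induction I rule: finite_induct)
  case empty
  show ?case by (intro exI[of _ id]) (auto simp: strict_mono_def)
next
  case (insert j I)
  then obtain r l where r: "strict_mono (r :: nat \<Rightarrow> nat)"
    and l: "\<forall>i\<in>I. (\<lambda>n. u (r n) i) \<longlonglongrightarrow> l i" by auto
  have "bounded (range (\<lambda>n. u (r n) j))"
    by (rule bounded_subset[OF insert.prems[of j]]) auto
  then obtain m s where s: "strict_mono (s :: nat \<Rightarrow> nat)"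
    and m: "(\<lambda>n. u (r (s n)) j) \<longlonglongrightarrow> m"
    using bounded_imp_convergent_subsequence unfolding o_def by blast
  have "(\<lambda>n. u (r (s n)) i) \<longlonglongrightarrow> l i" if "i \<in> I" for i
    using LIMSEQ_subseq_LIMSEQ[OF _ s, of "\<lambda>n. u (r n) i" "l i"] l that by (simp add: o_def)
  then show ?case
    using m insert.hyps strict_mono_o[OF r s]
    by (intro exI[of _ "r \<circ> s"] exI[of _ "l(j := m)"]) (auto simp: o_def)
qed

text \<open>The proximal term is centred at the points \<open>y n\<close> that violate exactness, and not at \<open>xbar\<close>, so that it
vanishes there and the minimal value stays below \<open>f xbar\<close>. Its weight \<open>Suc n\<close> tends to infinity,
which forces the minimisers towards \<open>xbar\<close> even when \<open>xbar\<close> is not a strict minimum, but is of smaller order than the penalty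
parameter \<open>(Suc n)\<^sup>2\<close>, so that it disappears from the rescaled optimality conditions.\<close>

lemma infeasible_penalised_minimisers:
  fixes f V :: "'a::euclidean_space \<Rightarrow> real"
  assumes f: "\<And>x. isCont f x" and V: "\<And>x. isCont V x" and V0: "\<And>x. 0 \<le> V x"
    and opt: "locally_optimal f {x. V x = 0} xbar"
    and not_exact: "\<not> (\<exists>\<kappa>>0. \<forall>\<kappa>'>\<kappa>. locally_optimal (\<lambda>x. f x + \<kappa>' * V x) UNIV xbar)"
  obtains x y where "x \<longlonglongrightarrow> xbar" "y \<longlonglongrightarrow> xbar" "\<forall>\<^sub>F n in sequentially. V (x n) > 0"
    "\<forall>\<^sub>F n in sequentially. \<forall>\<^sub>F z in nhds (x n).
      f (x n) + (real (Suc n))\<^sup>2 * V (x n) + real (Suc n) * (norm (x n - y n))\<^sup>2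
      \<le> f z + (real (Suc n))\<^sup>2 * V z + real (Suc n) * (norm (z - y n))\<^sup>2"
proof -
  obtain \<delta> where \<delta>: "\<delta> > 0" "\<And>x. V x = 0 \<Longrightarrow> dist xbar x < \<delta> \<Longrightarrow> f xbar \<le> f x" and Vxbar: "V xbar = 0"
    using opt unfolding locally_optimal_def by auto
  have "\<exists>y. dist xbar y < inverse (real (Suc n)) \<and> f y + (real (Suc n))\<^sup>2 * V y < f xbar" for n
  proof -
    have "(real (Suc n))\<^sup>2 > 0" by simp
    then obtain \<kappa>' where \<kappa>': "\<kappa>' > (real (Suc n))\<^sup>2"
      "\<not> locally_optimal (\<lambda>x. f x + \<kappa>' * V x) UNIV xbar"
      using not_exact by blast
    then obtain y where y: "dist xbar y < inverse (real (Suc n))" "f y + \<kappa>' * V y < f xbar"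
      using Vxbar unfolding locally_optimal_def
      by (force simp: not_le dest!: spec[of _ "inverse (real (Suc n))"])
    moreover have "(real (Suc n))\<^sup>2 * V y \<le> \<kappa>' * V y"
      using \<kappa>'(1) V0 by (intro mult_right_mono) auto
    ultimately show ?thesis by (intro exI[of _ y]) auto
  qed
  then obtain y where y: "\<And>n. dist xbar (y n) < inverse (real (Suc n))"
    "\<And>n. f (y n) + (real (Suc n))\<^sup>2 * V (y n) < f xbar"
    using choice[of "\<lambda>n y. dist xbar y < inverse (real (Suc n)) \<and> f y + (real (Suc n))\<^sup>2 * V y < f xbar"]
    by blast
  have y_lim: "y \<longlonglongrightarrow> xbar"
  proof -
    have "(\<lambda>n. dist (y n) xbar) \<longlonglongrightarrow> 0"
    proof (rule Lim_null_comparison[OF _ LIMSEQ_inverse_real_of_nat])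
      show "\<forall>\<^sub>F n in sequentially. norm (dist (y n) xbar) \<le> inverse (real (Suc n))"
      proof (rule always_eventually, rule allI)
        fix n show "norm (dist (y n) xbar) \<le> inverse (real (Suc n))"
          using less_imp_le[OF y(1)[of n]] by (simp add: dist_commute del: of_nat_Suc)
      qed
    qed
    then show ?thesis by (simp add: tendsto_dist_iff[of y])
  qed
  \<comment> \<open>Any radius below \<open>\<delta>\<close> would do: feasible points of \<open>C\<close> cannot have an objective value below \<open>f xbar\<close>.\<close>
  define C where "C = cball xbar (\<delta> / 2)"
  have C: "compact C" "C \<noteq> {}" using \<delta>(1) by (auto simp: C_def)
  define \<psi> where "\<psi> = (\<lambda>n z. f z + (real (Suc n))\<^sup>2 * V z + real (Suc n) * (norm (z - y n))\<^sup>2)"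
  have "continuous_on C (\<psi> n)" for n
    unfolding \<psi>_def
    by (intro continuous_at_imp_continuous_on ballI continuous_intros f V)
  then have "\<exists>x\<in>C. \<forall>z\<in>C. \<psi> n x \<le> \<psi> n z" for n
    by (rule continuous_attains_inf[OF C])
  then obtain x where xC: "\<And>n. x n \<in> C" and x: "\<And>n z. z \<in> C \<Longrightarrow> \<psi> n (x n) \<le> \<psi> n z"
    by metis
  obtain x0 where x0: "\<And>z. z \<in> C \<Longrightarrow> f x0 \<le> f z"
    using continuous_attains_inf[OF C, of f] f continuous_at_imp_continuous_on by blast
  have "\<forall>\<^sub>F n in sequentially. y n \<in> C"
    using tendstoD[OF y_lim half_gt_zero[OF \<delta>(1)]]
    by eventually_elim (simp add: C_def dist_commute)
  then have less: "\<forall>\<^sub>F n in sequentially. \<psi> n (x n) < f xbar"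
  proof eventually_elim
    fix n assume "y n \<in> C"
    then have "\<psi> n (x n) \<le> \<psi> n (y n)" by (rule x)
    also have "\<dots> < f xbar" using y(2)[of n] by (simp add: \<psi>_def)
    finally show "\<psi> n (x n) < f xbar" .
  qed
  then have "\<forall>\<^sub>F n in sequentially.
      norm ((norm (x n - y n))\<^sup>2) \<le> (f xbar - f x0) * inverse (real (Suc n))"
  proof eventually_elim
    fix n assume "\<psi> n (x n) < f xbar"
    moreover have "0 \<le> (real (Suc n))\<^sup>2 * V (x n)" using V0 by simp
    ultimately have "real (Suc n) * (norm (x n - y n))\<^sup>2 \<le> f xbar - f x0"
      using x0[OF xC[of n]] unfolding \<psi>_def by linarith
    then show "norm ((norm (x n - y n))\<^sup>2) \<le> (f xbar - f x0) * inverse (real (Suc n))"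
      by (simp add: field_simps)
  qed
  then have "(\<lambda>n. (norm (x n - y n))\<^sup>2) \<longlonglongrightarrow> 0"
    by (rule Lim_null_comparison)
       (rule tendsto_mult_right_zero[OF LIMSEQ_inverse_real_of_nat])
  then have "(\<lambda>n. x n - y n) \<longlonglongrightarrow> 0"
    by (simp add: power_tendsto_0_iff tendsto_norm_zero_iff)
  from tendsto_add[OF this y_lim] have x_lim: "x \<longlonglongrightarrow> xbar" by simp
  have pos: "\<forall>\<^sub>F n in sequentially. V (x n) > 0"
    using less
  proof eventually_elim
    fix n assume l: "\<psi> n (x n) < f xbar"
    have "V (x n) \<noteq> 0"
    proof
      assume "V (x n) = 0"
      moreover have "dist xbar (x n) < \<delta>"
        using xC[of n] \<delta>(1) by (auto simp: C_def)
      ultimately have "f xbar \<le> f (x n)" using \<delta>(2) by blast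
      with \<open>V (x n) = 0\<close> l show False
        unfolding \<psi>_def by (smt (verit) mult_nonneg_nonneg of_nat_0_le_iff zero_le_power2 mult_zero_right)
    qed
    then show "V (x n) > 0" using V0[of "x n"] by linarith
  qed
  have "\<forall>\<^sub>F n in sequentially. \<forall>\<^sub>F z in nhds (x n). \<psi> n (x n) \<le> \<psi> n z"
    using tendstoD[OF x_lim half_gt_zero[OF \<delta>(1)]]
  proof eventually_elim
    fix n assume "dist (x n) xbar < \<delta> / 2"
    then have "\<forall>\<^sub>F z in nhds (x n). z \<in> ball xbar (\<delta> / 2)"
      by (intro eventually_nhds_in_open) (auto simp: dist_commute)
    then show "\<forall>\<^sub>F z in nhds (x n). \<psi> n (x n) \<le> \<psi> n z"
      by eventually_elim (auto intro!: x simp: C_def)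
  qed
  with that[OF x_lim y_lim pos] show ?thesis unfolding \<psi>_def by blast
qed

text \<open>The assumption \<open>quasinormal\<close> is second-order quasi-normality of the program with equality constraints
\<open>I \<inter> E\<close> and inequality constraints \<open>I - E\<close>. The multiplier that refutes it is the limit of the residual vectors of the
minimisers above, divided by their norms.\<close>

theorem exact_penalty_if_second_order_quasinormal:
  fixes c :: "'i \<Rightarrow> real^'n \<Rightarrow> real"
  assumes fin: "finite I"
    and c: "\<And>i. i \<in> I \<Longrightarrow> twice_cont_diff (c i)" and f: "twice_cont_diff f"
    and opt: "locally_optimal f {x. violation E I c x = 0} xbar"
    and "\<epsilon> > 0"
    and rank: "(\<lambda>x. dim ((\<lambda>i. grad (c i) x) ` {i\<in>I. c i xbar = 0})) constant_on ball xbar \<epsilon>"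
    and quasinormal: "\<nexists>u. (\<exists>i\<in>I. u i \<noteq> 0) \<and> (\<forall>i\<in>I - E. 0 \<le> u i) \<and>
      (\<Sum>i\<in>I. u i *\<^sub>R grad (c i) xbar) = 0 \<and>
      (\<forall>d. (\<forall>i\<in>I. c i xbar = 0 \<longrightarrow> grad (c i) xbar \<bullet> d = 0) \<longrightarrow>
        0 \<le> (\<Sum>i\<in>I. u i * (d \<bullet> (hessian (c i) xbar *v d)))) \<and>
      (\<exists>xs. xs \<longlonglongrightarrow> xbar \<and> (\<forall>s. \<forall>i\<in>I. u i \<noteq> 0 \<longrightarrow> u i * c i (xs s) > 0))"
  shows "\<exists>\<kappa>>0. \<forall>\<kappa>'>\<kappa>. locally_optimal (\<lambda>x. f x + \<kappa>' * violation E I c x) UNIV xbar"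
proof (rule ccontr)
  assume not_exact: "\<not> ?thesis"
  define V where "V = violation E I c"
  have cont_c: "isCont (c i) z" if "i \<in> I" for i z
    by (rule isCont_twice_cont_diff[OF c[OF that]])
  obtain x y where x: "x \<longlonglongrightarrow> xbar" and y: "y \<longlonglongrightarrow> xbar"
    and pos: "\<forall>\<^sub>F n in sequentially. V (x n) > 0"
    and min: "\<forall>\<^sub>F n in sequentially. \<forall>\<^sub>F z in nhds (x n).
      f (x n) + (real (Suc n))\<^sup>2 * V (x n) + real (Suc n) * (norm (x n - y n))\<^sup>2
      \<le> f z + (real (Suc n))\<^sup>2 * V z + real (Suc n) * (norm (z - y n))\<^sup>2"
    using infeasible_penalised_minimisers[OF isCont_twice_cont_diff[OF f]
        isCont_violation[OF cont_c] violation_nonneg opt not_exact]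
    unfolding V_def by blast
  define u where "u = (\<lambda>n i. residual (i \<in> E) (c i (x n)) / V (x n))"
  have "\<bar>u n i\<bar> \<le> 1" if i: "i \<in> I" for n i
  proof -
    have "(residual (i \<in> E) (c i (x n)))\<^sup>2 \<le> (V (x n))\<^sup>2"
      unfolding V_def violation_sum_squares using fin i by (intro member_le_sum) auto
    then have "\<bar>residual (i \<in> E) (c i (x n))\<bar> \<le> \<bar>V (x n)\<bar>"
      by (simp add: abs_le_square_iff)
    then show ?thesis by (simp add: u_def divide_le_eq_1 abs_divide)
  qed
  then have "bounded (range (\<lambda>n. u n i))" if "i \<in> I" for i
    using that by (auto simp: bounded_iff)
  then obtain r l where r: "strict_mono (r :: nat \<Rightarrow> nat)"
    and l: "\<And>i. i \<in> I \<Longrightarrow> (\<lambda>k. u (r k) i) \<longlonglongrightarrow> l i"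
    using common_convergent_subsequence[OF fin, of u] by blast
  define X where "X = x \<circ> r"
  have X: "X \<longlonglongrightarrow> xbar" unfolding X_def by (rule LIMSEQ_subseq_LIMSEQ[OF x r])
  have Y: "(\<lambda>k. y (r k)) \<longlonglongrightarrow> xbar"
    using LIMSEQ_subseq_LIMSEQ[OF y r] by (simp add: o_def)
  define a where "a = (\<lambda>k. inverse (real (Suc (r k))))"
  have a: "a \<longlonglongrightarrow> 0" and a0: "\<And>k. a k > 0"
    using LIMSEQ_subseq_LIMSEQ[OF LIMSEQ_inverse_real_of_nat r] by (auto simp: a_def o_def)
  \<comment> \<open>The rescaling by \<open>(a k)\<^sup>2\<close> turns the penalty parameter into \<open>1\<close> and the proximal weight into \<open>a k\<close>.\<close>
  have aK: "(a k)\<^sup>2 * (real (Suc (r k)))\<^sup>2 = 1" "(a k)\<^sup>2 * (2 * real (Suc (r k))) = 2 * a k" for k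
  proof -
    have "(inverse b)\<^sup>2 * b\<^sup>2 = 1" "(inverse b)\<^sup>2 * (2 * b) = 2 * inverse b" if "b > 0" for b :: real
      using that by (simp_all add: power2_eq_square divide_simps)
    from this[of "real (Suc (r k))"]
    show "(a k)\<^sup>2 * (real (Suc (r k)))\<^sup>2 = 1" "(a k)\<^sup>2 * (2 * real (Suc (r k))) = 2 * a k"
      unfolding a_def by simp_all
  qed
  have posX: "\<forall>\<^sub>F k in sequentially. V (X k) > 0"
    unfolding X_def o_def by (rule eventually_subseq[OF r pos])
  have minX: "\<forall>\<^sub>F k in sequentially. \<forall>\<^sub>F z in nhds (X k).
      f (X k) + (real (Suc (r k)))\<^sup>2 * V (X k) + real (Suc (r k)) * (norm (X k - y (r k)))\<^sup>2
      \<le> f z + (real (Suc (r k)))\<^sup>2 * V z + real (Suc (r k)) * (norm (z - y (r k)))\<^sup>2"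
    unfolding X_def o_def by (rule eventually_subseq[OF r min])
  have grad_lim: "(\<lambda>k. grad (c i) (X k)) \<longlonglongrightarrow> grad (c i) xbar" if "i \<in> I" for i
    by (rule isCont_tendsto_compose[OF isCont_grad[OF c[OF that]] X])

  \<comment> \<open>The multiplier vectors have Euclidean norm \<open>1\<close>, and the norm passes to the limit.\<close>
  have "\<exists>i\<in>I. l i \<noteq> 0"
  proof (rule ccontr)
    assume "\<not> (\<exists>i\<in>I. l i \<noteq> 0)"
    have "(\<lambda>k. \<Sum>i\<in>I. (u (r k) i)\<^sup>2) \<longlonglongrightarrow> (\<Sum>i\<in>I. (l i)\<^sup>2)"
      by (intro tendsto_intros l)
    also have "(\<Sum>i\<in>I. (l i)\<^sup>2) = 0"
      using \<open>\<not> (\<exists>i\<in>I. l i \<noteq> 0)\<close> by simp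
    finally have "(\<lambda>k. \<Sum>i\<in>I. (u (r k) i)\<^sup>2) \<longlonglongrightarrow> 0" .
    moreover have "\<forall>\<^sub>F k in sequentially. (\<Sum>i\<in>I. (u (r k) i)\<^sup>2) = 1"
      using posX
    proof eventually_elim
      fix k assume p: "V (X k) > 0"
      have "(\<Sum>i\<in>I. (u (r k) i)\<^sup>2) = (\<Sum>i\<in>I. (residual (i \<in> E) (c i (X k)))\<^sup>2) / (V (X k))\<^sup>2"
        by (simp add: u_def X_def power_divide sum_divide_distrib)
      also have "\<dots> = 1" using p by (simp add: V_def flip: violation_sum_squares)
      finally show "(\<Sum>i\<in>I. (u (r k) i)\<^sup>2) = 1" .
    qed
    then have "(\<lambda>k. \<Sum>i\<in>I. (u (r k) i)\<^sup>2) \<longlonglongrightarrow> 1" by (rule tendsto_eventually)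
    ultimately show False using LIMSEQ_unique by fastforce
  qed

  moreover have "\<forall>i\<in>I - E. 0 \<le> l i"
  proof
    fix i assume i: "i \<in> I - E"
    have "0 \<le> u n i" for n
      using i by (simp add: u_def V_def residual_def violation_nonneg)
    then show "0 \<le> l i" using i by (intro LIMSEQ_le_const[OF l]) auto
  qed

  moreover have "(\<Sum>i\<in>I. l i *\<^sub>R grad (c i) xbar) = 0"
  proof -
    have "\<forall>\<^sub>F k in sequentially. (a k)\<^sup>2 *\<^sub>R grad f (X k)
        + (\<Sum>i\<in>I. u (r k) i *\<^sub>R grad (c i) (X k)) + (2 * a k) *\<^sub>R (X k - y (r k)) = 0"
      using posX minX
    proof eventually_elim
      case (elim k)
      have "grad f (X k) + (real (Suc (r k)))\<^sup>2 *\<^sub>R (\<Sum>i\<in>I. u (r k) i *\<^sub>R grad (c i) (X k))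
          + (2 * real (Suc (r k))) *\<^sub>R (X k - y (r k)) = 0"
        using penalised_minimum_conditions(1)[where f = f, OF c f elim[unfolded V_def]]
        by (simp add: u_def V_def X_def)
      then have "(a k)\<^sup>2 *\<^sub>R (grad f (X k) + (real (Suc (r k)))\<^sup>2 *\<^sub>R (\<Sum>i\<in>I. u (r k) i *\<^sub>R grad (c i) (X k))
          + (2 * real (Suc (r k))) *\<^sub>R (X k - y (r k))) = 0"
        by simp
      then show ?case
        unfolding scaleR_add_right scaleR_scaleR aK by simp
    qed
    moreover have "(\<lambda>k. (a k)\<^sup>2 *\<^sub>R grad f (X k)
        + (\<Sum>i\<in>I. u (r k) i *\<^sub>R grad (c i) (X k)) + (2 * a k) *\<^sub>R (X k - y (r k))) \<longlonglongrightarrow>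
        0\<^sup>2 *\<^sub>R grad f xbar + (\<Sum>i\<in>I. l i *\<^sub>R grad (c i) xbar) + (2 * 0) *\<^sub>R (xbar - xbar)"
      by (intro tendsto_intros a X Y l grad_lim isCont_tendsto_compose[OF isCont_grad[OF f] X])
    ultimately have "(\<lambda>k. 0) \<longlonglongrightarrow> (\<Sum>i\<in>I. l i *\<^sub>R grad (c i) xbar)"
      using tendsto_cong[THEN iffD1] by fastforce
    then show ?thesis using LIMSEQ_unique tendsto_const by blast
  qed

  moreover have "\<forall>d. (\<forall>i\<in>I. c i xbar = 0 \<longrightarrow> grad (c i) xbar \<bullet> d = 0) \<longrightarrow>
      0 \<le> (\<Sum>i\<in>I. l i * (d \<bullet> (hessian (c i) xbar *v d)))"
  proof (intro allI impI)
    fix d assume d: "\<forall>i\<in>I. c i xbar = 0 \<longrightarrow> grad (c i) xbar \<bullet> d = 0"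
    define A where "A = {i\<in>I. c i xbar = 0}"
    obtain D where D: "\<And>z. z \<in> ball xbar \<epsilon> \<Longrightarrow> dim ((\<lambda>i. grad (c i) z) ` A) = D"
      using rank unfolding constant_on_def A_def by blast
    have "\<forall>\<^sub>F k in sequentially. dim ((\<lambda>i. grad (c i) (X k)) ` A) = dim ((\<lambda>i. grad (c i) xbar) ` A)"
      using tendstoD[OF X \<open>\<epsilon> > 0\<close>]
      by eventually_elim (use D \<open>\<epsilon> > 0\<close> in \<open>simp add: dist_commute\<close>)
    then have "\<exists>d'. (d' \<longlongrightarrow> d) sequentially \<and> (\<forall>k. \<forall>i\<in>A. grad (c i) (X k) \<bullet> d' k = 0)"
      using fin d grad_lim by (intro kernel_vector_approximation) (auto simp: A_def)
    then obtain d' where d': "d' \<longlonglongrightarrow> d"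
      and d'0: "\<And>k i. i \<in> A \<Longrightarrow> grad (c i) (X k) \<bullet> d' k = 0" by blast
    have inactive: "i \<notin> E \<and> c i xbar < 0" if "i \<in> I - A" for i
    proof -
      have "violation E I c xbar = 0" using opt by (simp add: locally_optimal_def)
      with that show ?thesis
        unfolding violation_eq_0_iff[OF fin] by (force simp: A_def split: if_splits)
    qed
    have "\<forall>\<^sub>F k in sequentially. c i (X k) < 0" if i: "i \<in> I - A" for i
      using isCont_tendsto_compose[OF cont_c X, of i] inactive[OF i] i order_tendstoD(2) by blast
    then have neg: "\<forall>\<^sub>F k in sequentially. \<forall>i\<in>I - A. c i (X k) < 0"
      using fin by (simp add: eventually_ball_finite)
    have "\<forall>\<^sub>F k in sequentially. 0 \<le> (a k)\<^sup>2 * (d' k \<bullet> (hessian f (X k) *v d' k))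
        + (\<Sum>i\<in>I. u (r k) i * (d' k \<bullet> (hessian (c i) (X k) *v d' k))) + 2 * a k * (d' k \<bullet> d' k)"
      using posX minX neg
    proof eventually_elim
      case (elim k)
      have "0 \<le> d' k \<bullet> (hessian f (X k) *v d' k) + (real (Suc (r k)))\<^sup>2 *
          (\<Sum>i\<in>I. u (r k) i * (d' k \<bullet> (hessian (c i) (X k) *v d' k)))
          + 2 * real (Suc (r k)) * (d' k \<bullet> d' k)"
        using penalised_minimum_conditions(2)[where f = f, OF c f elim(1,2)[unfolded V_def], of "d' k"]
          elim(3) inactive d'0
        by (force simp: u_def V_def X_def)
      then have "0 \<le> (a k)\<^sup>2 * (d' k \<bullet> (hessian f (X k) *v d' k) + (real (Suc (r k)))\<^sup>2 *
          (\<Sum>i\<in>I. u (r k) i * (d' k \<bullet> (hessian (c i) (X k) *v d' k)))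
          + 2 * real (Suc (r k)) * (d' k \<bullet> d' k))"
        by (intro mult_nonneg_nonneg) auto
      then show ?case
        unfolding distrib_left mult.assoc[symmetric] aK(1) aK(2)[unfolded mult.assoc[symmetric]] by simp
    qed
    moreover have "(\<lambda>k. (a k)\<^sup>2 * (d' k \<bullet> (hessian f (X k) *v d' k))
        + (\<Sum>i\<in>I. u (r k) i * (d' k \<bullet> (hessian (c i) (X k) *v d' k))) + 2 * a k * (d' k \<bullet> d' k))
      \<longlonglongrightarrow> 0\<^sup>2 * (d \<bullet> (hessian f xbar *v d))
        + (\<Sum>i\<in>I. l i * (d \<bullet> (hessian (c i) xbar *v d))) + 2 * 0 * (d \<bullet> d)"
      by (intro tendsto_intros a l d' tendsto_hessian_quadratic_form c f X)
    ultimately have "0 \<le> 0\<^sup>2 * (d \<bullet> (hessian f xbar *v d))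
        + (\<Sum>i\<in>I. l i * (d \<bullet> (hessian (c i) xbar *v d))) + 2 * 0 * (d \<bullet> d)"
      by (intro tendsto_lowerbound) auto
    then show "0 \<le> (\<Sum>i\<in>I. l i * (d \<bullet> (hessian (c i) xbar *v d)))" by simp
  qed

  moreover have "\<exists>xs. xs \<longlonglongrightarrow> xbar \<and> (\<forall>s. \<forall>i\<in>I. l i \<noteq> 0 \<longrightarrow> l i * c i (xs s) > 0)"
  proof -
    \<comment> \<open>A nonzero limit has the sign of the residual, and a nonzero residual equals the constraint value.\<close>
    have "\<forall>\<^sub>F k in sequentially. l i \<noteq> 0 \<longrightarrow> l i * c i (X k) > 0" if i: "i \<in> I" for i
    proof (cases "l i = 0")
      case False
      have "(\<lambda>k. l i * u (r k) i) \<longlonglongrightarrow> l i * l i"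
        by (intro tendsto_intros l i)
      moreover have "l i * l i > 0" using False by (metis not_real_square_gt_zero)
      ultimately have "\<forall>\<^sub>F k in sequentially. 0 < l i * u (r k) i"
        by (rule order_tendstoD(1))
      then show ?thesis
        using posX
      proof eventually_elim
        case (elim k)
        have "residual (i \<in> E) (c i (X k)) \<noteq> 0"
          using elim(1) by (auto simp: u_def X_def)
        then have "residual (i \<in> E) (c i (X k)) = c i (X k)"
          by (auto simp: residual_def max_def split: if_splits)
        then have "u (r k) i * V (X k) = c i (X k)"
          using elim(2) by (simp add: u_def X_def)
        then have "l i * c i (X k) = (l i * u (r k) i) * V (X k)" by (metis mult.assoc)
        also have "\<dots> > 0" using elim by (rule mult_pos_pos)
        finally show ?case by simp
      qed
    qed simp
    then have "\<forall>\<^sub>F k in sequentially. \<forall>i\<in>I. l i \<noteq> 0 \<longrightarrow> l i * c i (X k) > 0"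
      using fin by (simp add: eventually_ball_finite)
    then obtain N where "\<And>k. k \<ge> N \<Longrightarrow> \<forall>i\<in>I. l i \<noteq> 0 \<longrightarrow> l i * c i (X k) > 0"
      unfolding eventually_sequentially by blast
    then show ?thesis
      using LIMSEQ_ignore_initial_segment[OF X, of N]
      by (intro exI[of _ "\<lambda>s. X (s + N)"]) auto
  qed

  ultimately show False using quasinormal by blast
qed

section \<open>The branches of a program with switching constraints\<close>

datatype constr_index = Ineq nat | Equal nat | Switch_G nat | Switch_H nat

primrec constr :: "'n::finite mpsc \<Rightarrow> constr_index \<Rightarrow> real^'n \<Rightarrow> real" where
  "constr P (Ineq i) = g_fun P i"
| "constr P (Equal j) = h_fun P j"
| "constr P (Switch_G k) = G_fun P k"
| "constr P (Switch_H k) = H_fun P k"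

definition equalities :: "constr_index set" where
  "equalities = - range Ineq"

definition branch :: "'n::finite mpsc \<Rightarrow> real^'n \<Rightarrow> nat set \<Rightarrow> nat set \<Rightarrow> constr_index set" where
  "branch P xbar \<beta>1 \<beta>2 = Ineq ` {1..n_ineq P} \<union> Equal ` {1..n_eq P} \<union>
     Switch_G ` (I_G P xbar \<union> \<beta>1) \<union> Switch_H ` (I_H P xbar \<union> \<beta>2)"

lemma in_equalities [simp]:
  "Ineq i \<notin> equalities" "Equal i \<in> equalities" "Switch_G i \<in> equalities" "Switch_H i \<in> equalities"
  by (auto simp: equalities_def)

lemma finite_index_sets [simp]: "finite (I_G P xbar)" "finite (I_H P xbar)" "finite (I_GH P xbar)"
  by (simp_all add: I_G_def I_H_def I_GH_def)

lemma finite_bipartitions: "finite I \<Longrightarrow> finite (bipartitions I)"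
  by (rule finite_subset[of _ "Pow I \<times> Pow I"]) (auto simp: bipartitions_def)

context
  fixes P :: "'n::finite mpsc" and xbar :: "real^'n" and \<beta>1 \<beta>2
  assumes bp: "(\<beta>1, \<beta>2) \<in> bipartitions (I_GH P xbar)"
begin

lemma bipartition_subsets: "\<beta>1 \<subseteq> I_GH P xbar" "\<beta>2 \<subseteq> I_GH P xbar" "finite \<beta>1" "finite \<beta>2"
proof -
  show "\<beta>1 \<subseteq> I_GH P xbar" "\<beta>2 \<subseteq> I_GH P xbar"
    using bp by (auto simp: bipartitions_def)
  then show "finite \<beta>1" "finite \<beta>2"
    using finite_subset finite_index_sets(3) by blast+
qed

lemma finite_branch: "finite (branch P xbar \<beta>1 \<beta>2)"
  by (simp add: branch_def bipartition_subsets)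

lemma sum_branch:
  fixes F :: "constr_index \<Rightarrow> 'b::comm_monoid_add"
  shows "sum F (branch P xbar \<beta>1 \<beta>2) =
    (\<Sum>i\<in>{1..n_ineq P}. F (Ineq i)) + (\<Sum>j\<in>{1..n_eq P}. F (Equal j)) +
    (\<Sum>k\<in>I_G P xbar \<union> \<beta>1. F (Switch_G k)) + (\<Sum>k\<in>I_H P xbar \<union> \<beta>2. F (Switch_H k))"
proof -
  have "sum F (Ineq ` A \<union> Equal ` B \<union> Switch_G ` C \<union> Switch_H ` D) =
      (\<Sum>i\<in>A. F (Ineq i)) + (\<Sum>j\<in>B. F (Equal j)) + (\<Sum>k\<in>C. F (Switch_G k)) + (\<Sum>k\<in>D. F (Switch_H k))"
    if "finite A" "finite B" "finite C" "finite D" for A B C D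
    using that
    by ((subst sum.union_disjoint, simp, simp, force)+) (simp add: sum.reindex inj_on_def)
  then show ?thesis by (simp add: branch_def bipartition_subsets)
qed

lemma violation_branch_square:
  "(violation equalities (branch P xbar \<beta>1 \<beta>2) (constr P) x)\<^sup>2 =
     (\<Sum>i\<in>{1..n_ineq P}. (max (g_fun P i x) 0)\<^sup>2) + (\<Sum>j\<in>{1..n_eq P}. (h_fun P j x)\<^sup>2) +
     (\<Sum>k\<in>I_G P xbar \<union> \<beta>1. (G_fun P k x)\<^sup>2) + (\<Sum>k\<in>I_H P xbar \<union> \<beta>2. (H_fun P k x)\<^sup>2)"
  by (simp add: violation_sum_squares sum_branch residual_def)

lemma ball_branch_iff:
  "(\<forall>i\<in>branch P xbar \<beta>1 \<beta>2. Q i) \<longleftrightarrow>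
     (\<forall>i\<in>{1..n_ineq P}. Q (Ineq i)) \<and> (\<forall>j\<in>{1..n_eq P}. Q (Equal j)) \<and>
     (\<forall>k\<in>I_G P xbar \<union> \<beta>1. Q (Switch_G k)) \<and> (\<forall>k\<in>I_H P xbar \<union> \<beta>2. Q (Switch_H k))"
  unfolding branch_def by blast

lemma switch_vanishes_at_xbar:
  "k \<in> I_G P xbar \<union> \<beta>1 \<Longrightarrow> G_fun P k xbar = 0" "k \<in> I_H P xbar \<union> \<beta>2 \<Longrightarrow> H_fun P k xbar = 0"
  using bipartition_subsets by (auto simp: I_G_def I_H_def I_GH_def)

context
  assumes feas: "xbar \<in> feasible P"
begin

text \<open>Feasibility of \<open>xbar\<close> excludes switching indices at which neither function vanishes, so a branch
demands of every switching pair that one of the two functions be zero.\<close>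

lemma switch_cover: "{1..n_sw P} = (I_G P xbar \<union> \<beta>1) \<union> (I_H P xbar \<union> \<beta>2)"
  using bp feas by (auto simp: bipartitions_def feasible_def I_G_def I_H_def I_GH_def)

lemma switch_disjoint: "(I_G P xbar \<union> \<beta>1) \<inter> (I_H P xbar \<union> \<beta>2) = {}"
  using bp by (auto simp: bipartitions_def I_G_def I_H_def I_GH_def)

lemma branch_feasible_subset:
  "{x. violation equalities (branch P xbar \<beta>1 \<beta>2) (constr P) x = 0} \<subseteq> feasible P"
proof
  fix x assume "x \<in> {x. violation equalities (branch P xbar \<beta>1 \<beta>2) (constr P) x = 0}"
  then have *: "\<forall>i\<in>{1..n_ineq P}. g_fun P i x \<le> 0" "\<forall>j\<in>{1..n_eq P}. h_fun P j x = 0"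
    "\<forall>k\<in>I_G P xbar \<union> \<beta>1. G_fun P k x = 0" "\<forall>k\<in>I_H P xbar \<union> \<beta>2. H_fun P k x = 0"
    by (simp_all add: violation_eq_0_iff[OF finite_branch] ball_branch_iff)
  have "\<forall>k\<in>{1..n_sw P}. G_fun P k x * H_fun P k x = 0"
    unfolding switch_cover using *(3,4) by auto
  with *(1,2) show "x \<in> feasible P" by (simp add: feasible_def)
qed

lemma xbar_branch_feasible: "violation equalities (branch P xbar \<beta>1 \<beta>2) (constr P) xbar = 0"
  using feas switch_vanishes_at_xbar
  by (auto simp: violation_eq_0_iff[OF finite_branch] ball_branch_iff feasible_def)

text \<open>The hypotheses on the branch refer to the constraints active at \<open>xbar\<close>; apart from the inequalities every constraint
of a branch is active there.\<close>

lemma gradient_family_eq: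
  "gradient_family P xbar \<beta>1 \<beta>2 x =
     (\<lambda>i. grad (constr P i) x) ` {i\<in>branch P xbar \<beta>1 \<beta>2. constr P i xbar = 0}"
proof -
  have h0: "h_fun P j xbar = 0" if "j \<in> {1..n_eq P}" for j
    using feas that by (simp add: feasible_def)
  have "{i\<in>branch P xbar \<beta>1 \<beta>2. constr P i xbar = 0} =
      Ineq ` I_g P xbar \<union> Equal ` I_h P \<union> Switch_G ` (I_G P xbar \<union> \<beta>1) \<union> Switch_H ` (I_H P xbar \<union> \<beta>2)"
    (is "?L = ?R")
  proof
    show "?L \<subseteq> ?R" by (auto simp: branch_def I_g_def I_h_def)
    show "?R \<subseteq> ?L"
      using h0 switch_vanishes_at_xbar unfolding branch_def I_g_def I_h_def by fastforce
  qed
  then show ?thesis by (simp add: gradient_family_def image_Un image_image)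
qed

lemma critical_subspace_iff:
  "d \<in> critical_subspace P xbar \<beta>1 \<beta>2 \<longleftrightarrow>
     (\<forall>i\<in>branch P xbar \<beta>1 \<beta>2. constr P i xbar = 0 \<longrightarrow> grad (constr P i) xbar \<bullet> d = 0)"
  using feas switch_vanishes_at_xbar
  by (auto simp: critical_subspace_def ball_branch_iff I_g_def I_h_def feasible_def)

lemma quadratic_form_multiplier_hessian:
  "d \<bullet> (multiplier_hessian P xbar \<beta>1 \<beta>2 (u \<circ> Ineq) (u \<circ> Equal) (u \<circ> Switch_G) (u \<circ> Switch_H) *v d) =
     (\<Sum>i\<in>branch P xbar \<beta>1 \<beta>2. u i * (d \<bullet> (hessian (constr P i) xbar *v d)))"
proof -
  have lin: "linear (\<lambda>A :: real^'n^'n. d \<bullet> (A *v d))"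
    by (rule linearI)
       (simp_all add: matrix_vector_mult_add_rdistrib inner_add_right scaleR_matrix_vector_assoc[symmetric])
  have "multiplier_hessian P xbar \<beta>1 \<beta>2 (u \<circ> Ineq) (u \<circ> Equal) (u \<circ> Switch_G) (u \<circ> Switch_H) =
      (\<Sum>i\<in>branch P xbar \<beta>1 \<beta>2. u i *\<^sub>R hessian (constr P i) xbar)"
    by (simp add: multiplier_hessian_def sum_branch)
  then show ?thesis
    by (simp add: linear_sum[OF lin] linear_cmul[OF lin])
qed

text \<open>Each branch has a feasible set contained in that of the whole program and containing \<open>xbar\<close>, so it
inherits local optimality; the two piecewise conditions provide the remaining hypotheses.\<close>

lemma branch_exact_penalty:
  assumes smooth: "mpsc_smooth P" and opt: "locally_optimal (obj P) (feasible P) xbar"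
    and rank: "MPSC_PWCR P xbar" and qn: "MPSC_PSOQN P xbar"
  shows "\<exists>\<kappa>>0. \<forall>\<kappa>'>\<kappa>. locally_optimal
    (\<lambda>x. obj P x + \<kappa>' * violation equalities (branch P xbar \<beta>1 \<beta>2) (constr P) x) UNIV xbar"
proof -
  have sub: "I_G P xbar \<union> \<beta>1 \<subseteq> {1..n_sw P}" "I_H P xbar \<union> \<beta>2 \<subseteq> {1..n_sw P}"
    using bipartition_subsets by (auto simp: I_G_def I_H_def I_GH_def)
  obtain \<epsilon> where \<epsilon>: "\<epsilon> > 0" "(\<lambda>x. dim (gradient_family P xbar \<beta>1 \<beta>2 x)) constant_on ball xbar \<epsilon>"
    using rank bp unfolding MPSC_PWCR_def by blast
  show ?thesis
  proof (rule exact_penalty_if_second_order_quasinormal[OF finite_branch])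
    have "\<forall>i\<in>branch P xbar \<beta>1 \<beta>2. twice_cont_diff (constr P i)"
      using smooth sub unfolding ball_branch_iff mpsc_smooth_def by auto
    then show "twice_cont_diff (constr P i)" if "i \<in> branch P xbar \<beta>1 \<beta>2" for i
      using that by blast
    show "twice_cont_diff (obj P)" using smooth by (simp add: mpsc_smooth_def)
    show "locally_optimal (obj P) {x. violation equalities (branch P xbar \<beta>1 \<beta>2) (constr P) x = 0} xbar"
      using opt xbar_branch_feasible branch_feasible_subset unfolding locally_optimal_def by blast
    show "\<epsilon> > 0" by (rule \<epsilon>(1))
    show "(\<lambda>x. dim ((\<lambda>i. grad (constr P i) x) ` {i\<in>branch P xbar \<beta>1 \<beta>2. constr P i xbar = 0}))
        constant_on ball xbar \<epsilon>"
      using \<epsilon>(2) by (simp add: gradient_family_eq)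
    show "\<nexists>u. (\<exists>i\<in>branch P xbar \<beta>1 \<beta>2. u i \<noteq> 0) \<and> (\<forall>i\<in>branch P xbar \<beta>1 \<beta>2 - equalities. 0 \<le> u i) \<and>
      (\<Sum>i\<in>branch P xbar \<beta>1 \<beta>2. u i *\<^sub>R grad (constr P i) xbar) = 0 \<and>
      (\<forall>d. (\<forall>i\<in>branch P xbar \<beta>1 \<beta>2. constr P i xbar = 0 \<longrightarrow> grad (constr P i) xbar \<bullet> d = 0) \<longrightarrow>
        0 \<le> (\<Sum>i\<in>branch P xbar \<beta>1 \<beta>2. u i * (d \<bullet> (hessian (constr P i) xbar *v d)))) \<and>
      (\<exists>xs. xs \<longlonglongrightarrow> xbar \<and> (\<forall>s. \<forall>i\<in>branch P xbar \<beta>1 \<beta>2. u i \<noteq> 0 \<longrightarrow> u i * constr P i (xs s) > 0))"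
    proof (rule notI, elim exE conjE)
      fix u :: "constr_index \<Rightarrow> real" and xs
      let ?lam = "u \<circ> Ineq" and ?\<rho> = "u \<circ> Equal" and ?\<mu> = "u \<circ> Switch_G" and ?\<nu> = "u \<circ> Switch_H"
      assume nz: "\<exists>i\<in>branch P xbar \<beta>1 \<beta>2. u i \<noteq> 0"
        and nonneg: "\<forall>i\<in>branch P xbar \<beta>1 \<beta>2 - equalities. 0 \<le> u i"
        and stat: "(\<Sum>i\<in>branch P xbar \<beta>1 \<beta>2. u i *\<^sub>R grad (constr P i) xbar) = 0"
        and curv: "\<forall>d. (\<forall>i\<in>branch P xbar \<beta>1 \<beta>2. constr P i xbar = 0 \<longrightarrow> grad (constr P i) xbar \<bullet> d = 0) \<longrightarrow>
          0 \<le> (\<Sum>i\<in>branch P xbar \<beta>1 \<beta>2. u i * (d \<bullet> (hessian (constr P i) xbar *v d)))"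
        and xs: "xs \<longlonglongrightarrow> xbar"
          "\<forall>s. \<forall>i\<in>branch P xbar \<beta>1 \<beta>2. u i \<noteq> 0 \<longrightarrow> u i * constr P i (xs s) > 0"
      have "nonzero_multiplier P xbar \<beta>1 \<beta>2 ?lam ?\<rho> ?\<mu> ?\<nu>"
        using nz unfolding nonzero_multiplier_def branch_def by auto
      moreover have "\<forall>i\<in>{1..n_ineq P}. ?lam i \<ge> 0"
        using nonneg by (auto simp: branch_def)
      moreover have "stationary_multiplier P xbar \<beta>1 \<beta>2 ?lam ?\<rho> ?\<mu> ?\<nu>"
        using stat by (simp add: stationary_multiplier_def sum_branch)
      moreover have "\<forall>d\<in>critical_subspace P xbar \<beta>1 \<beta>2.
          d \<bullet> (multiplier_hessian P xbar \<beta>1 \<beta>2 ?lam ?\<rho> ?\<mu> ?\<nu> *v d) \<ge> 0"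
      proof
        fix d assume "d \<in> critical_subspace P xbar \<beta>1 \<beta>2"
        with curv show "d \<bullet> (multiplier_hessian P xbar \<beta>1 \<beta>2 ?lam ?\<rho> ?\<mu> ?\<nu> *v d) \<ge> 0"
          unfolding critical_subspace_iff quadratic_form_multiplier_hessian by blast
      qed
      moreover have "quasi_normality_sequence P xbar \<beta>1 \<beta>2 ?lam ?\<rho> ?\<mu> ?\<nu> xs"
        using xs unfolding quasi_normality_sequence_def ball_branch_iff by auto
      ultimately show False
        using qn bp unfolding MPSC_PSOQN_def by blast
    qed
  qed
qed

end

end

text \<open>By continuity, an index at which only one function vanishes at \<open>xbar\<close> has its minimum attained by that
function throughout a neighbourhood. At a biactive index either function may attain the minimum, depending on
\<open>x\<close>; the bipartition records which.\<close>

lemma penalty_eq_branch_penalty_near: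
  assumes smooth: "mpsc_smooth P" and feas: "xbar \<in> feasible P"
  shows "\<forall>\<^sub>F x in nhds xbar. \<exists>(\<beta>1, \<beta>2) \<in> bipartitions (I_GH P xbar). \<forall>\<kappa>.
    penalty P \<kappa> x = obj P x + \<kappa> * violation equalities (branch P xbar \<beta>1 \<beta>2) (constr P) x"
proof -
  have cont: "(G_fun P k \<longlongrightarrow> G_fun P k xbar) (nhds xbar)" "(H_fun P k \<longlongrightarrow> H_fun P k xbar) (nhds xbar)"
    if "k \<in> {1..n_sw P}" for k
    using smooth that by (auto simp: mpsc_smooth_def isCont_iff_tendsto_nhds[symmetric] isCont_twice_cont_diff)
  have "\<forall>\<^sub>F x in nhds xbar. 0 < (H_fun P k x)\<^sup>2 - (G_fun P k x)\<^sup>2" if "k \<in> I_G P xbar" for k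
    by (rule order_tendstoD(1)[OF tendsto_diff[OF tendsto_power tendsto_power]])
       (use that in \<open>auto simp: I_G_def intro!: cont\<close>)
  then have 1: "\<forall>\<^sub>F x in nhds xbar. \<forall>k\<in>I_G P xbar. 0 < (H_fun P k x)\<^sup>2 - (G_fun P k x)\<^sup>2"
    by (simp add: eventually_ball_finite)
  have "\<forall>\<^sub>F x in nhds xbar. 0 < (G_fun P k x)\<^sup>2 - (H_fun P k x)\<^sup>2" if "k \<in> I_H P xbar" for k
    by (rule order_tendstoD(1)[OF tendsto_diff[OF tendsto_power tendsto_power]])
       (use that in \<open>auto simp: I_H_def intro!: cont\<close>)
  then have 2: "\<forall>\<^sub>F x in nhds xbar. \<forall>k\<in>I_H P xbar. 0 < (G_fun P k x)\<^sup>2 - (H_fun P k x)\<^sup>2"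
    by (simp add: eventually_ball_finite)
  from 1 2 show ?thesis
  proof eventually_elim
    case (elim x)
    define \<beta>1 where "\<beta>1 = {k\<in>I_GH P xbar. (G_fun P k x)\<^sup>2 \<le> (H_fun P k x)\<^sup>2}"
    define \<beta>2 where "\<beta>2 = I_GH P xbar - \<beta>1"
    have bp: "(\<beta>1, \<beta>2) \<in> bipartitions (I_GH P xbar)"
      by (auto simp: bipartitions_def \<beta>1_def \<beta>2_def)
    have "(\<Sum>k=1..n_sw P. min ((G_fun P k x)\<^sup>2) ((H_fun P k x)\<^sup>2)) =
        (\<Sum>k\<in>I_G P xbar \<union> \<beta>1. min ((G_fun P k x)\<^sup>2) ((H_fun P k x)\<^sup>2)) +
        (\<Sum>k\<in>I_H P xbar \<union> \<beta>2. min ((G_fun P k x)\<^sup>2) ((H_fun P k x)\<^sup>2))"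
      unfolding switch_cover[OF bp feas]
      by (intro sum.union_disjoint switch_disjoint[OF bp feas]) (simp_all add: bipartition_subsets[OF bp])
    also have "(\<Sum>k\<in>I_G P xbar \<union> \<beta>1. min ((G_fun P k x)\<^sup>2) ((H_fun P k x)\<^sup>2)) =
        (\<Sum>k\<in>I_G P xbar \<union> \<beta>1. (G_fun P k x)\<^sup>2)"
      using elim(1) by (intro sum.cong) (auto simp: \<beta>1_def min_def not_le)
    also have "(\<Sum>k\<in>I_H P xbar \<union> \<beta>2. min ((G_fun P k x)\<^sup>2) ((H_fun P k x)\<^sup>2)) =
        (\<Sum>k\<in>I_H P xbar \<union> \<beta>2. (H_fun P k x)\<^sup>2)"
      using elim(2) by (intro sum.cong) (auto simp: \<beta>1_def \<beta>2_def min_def not_le)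
    finally have "penalty P \<kappa> x =
        obj P x + \<kappa> * sqrt ((violation equalities (branch P xbar \<beta>1 \<beta>2) (constr P) x)\<^sup>2)" for \<kappa>
      unfolding penalty_def violation_branch_square[OF bp] by (simp add: add.assoc)
    then show ?case
      using bp by (intro bexI[of _ "(\<beta>1, \<beta>2)"]) (auto simp: violation_nonneg)
  qed
qed

section \<open>Exact penalisation of the switching constraints\<close>

theorem corollary6p1:
  fixes P :: "'n::finite mpsc" and xbar :: "real^'n"
  assumes "mpsc_smooth P"
    and "xbar \<in> feasible P"
    and "locally_optimal (obj P) (feasible P) xbar"
    and "MPSC_PWCR P xbar"
    and "MPSC_PSOQN P xbar"
  shows "\<exists>\<kappa>bar>0. \<forall>\<kappa>>\<kappa>bar. locally_optimal (penalty P \<kappa>) UNIV xbar"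
proof -
  define V where "V = (\<lambda>b. violation equalities (branch P xbar (fst b) (snd b)) (constr P))"
  define BP where "BP = bipartitions (I_GH P xbar)"
  have "\<exists>K>0. \<forall>\<kappa>>K. locally_optimal (\<lambda>x. obj P x + \<kappa> * V b x) UNIV xbar" if "b \<in> BP" for b
    using branch_exact_penalty[of "fst b" "snd b" P xbar] that assms by (simp add: V_def BP_def)
  then obtain K where K: "\<And>b. b \<in> BP \<Longrightarrow> K b > 0"
    "\<And>b \<kappa>. b \<in> BP \<Longrightarrow> \<kappa> > K b \<Longrightarrow> locally_optimal (\<lambda>x. obj P x + \<kappa> * V b x) UNIV xbar"
    by metis
  have fin: "finite BP" unfolding BP_def by (simp add: finite_bipartitions)
  define \<kappa>bar where "\<kappa>bar = 1 + sum K BP"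
  have bar: "K b < \<kappa>bar" if "b \<in> BP" for b
    using member_le_sum[OF that _ fin, of K] K(1) by (force simp: \<kappa>bar_def)
  have "\<kappa>bar > 0" using sum_nonneg[of BP K] K(1) by (force simp: \<kappa>bar_def)
  moreover have "locally_optimal (penalty P \<kappa>) UNIV xbar" if \<kappa>: "\<kappa> > \<kappa>bar" for \<kappa>
  proof -
    have "\<forall>\<^sub>F x in nhds xbar. obj P xbar + \<kappa> * V b xbar \<le> obj P x + \<kappa> * V b x" if "b \<in> BP" for b
      using K(2)[OF that less_trans[OF bar[OF that] \<kappa>]]
      by (auto simp: locally_optimal_def eventually_nhds_metric dist_commute)
    then have optimal: "\<forall>\<^sub>F x in nhds xbar. \<forall>b\<in>BP.
        obj P xbar + \<kappa> * V b xbar \<le> obj P x + \<kappa> * V b x"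
      by (simp add: eventually_ball_finite fin)
    have near: "\<forall>\<^sub>F x in nhds xbar. \<exists>b\<in>BP. \<forall>\<kappa>. penalty P \<kappa> x = obj P x + \<kappa> * V b x"
      using penalty_eq_branch_penalty_near[OF assms(1,2)] by (simp add: V_def BP_def case_prod_beta)
    have V0: "V b xbar = 0" if "b \<in> BP" for b
      using xbar_branch_feasible[of "fst b" "snd b" P xbar] that assms(2) by (simp add: V_def BP_def)
    have xbar: "penalty P \<kappa> xbar = obj P xbar"
      using eventually_nhds_x_imp_x[OF near] V0 by auto
    from near optimal have "\<forall>\<^sub>F x in nhds xbar. penalty P \<kappa> xbar \<le> penalty P \<kappa> x"
      by eventually_elim (use xbar V0 in fastforce)
    then show ?thesis
      by (auto simp: locally_optimal_def eventually_nhds_metric dist_commute)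
  qed
  ultimately show ?thesis by blast
qed

end
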